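(* Let $S=\begin{pmatrix}A&B\\C&D\end{pmatrix}\in\mathrm{Sp}(d,\mathbb{R})$ with blocks $A,B,C,D\in\mathbb{R}^{d\times d}$, let $\hat S$ be a metaplectic operator with projection $S$, let $k\in\mathcal{S}'(\mathbb{R}^{2d})$ be its Schwartz kernel, and let $\tilde k=k*\varphi$ be its smoothed kernel, where $\varphi(t)=e^{-\pi|t|^2}$, $t\in\mathbb{R}^{2d}$. Then $\tilde k$ decays off the manifold $$\Gamma_S=\{(x,D^Tx): x\in R(C)^\perp\},$$ that is, there exist a constant $c>0$ and a positive semi-definite quadratic form $\mathcal{Q}_S$ on $\mathbb{R}^{2d}$ such that $|\tilde k(x,y)|=c\,e^{-\pi\mathcal{Q}_S(x,y)}$ for all $x,y\in\mathbb{R}^d$ and $$\{(x,y)\in\mathbb{R}^{2d}:\mathcal{Q}_S(x,y)=0\}=\{(x,D^Tx): x\in R(C)^\perp\}.$$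
   Context: $\mathrm{Sp}(d,\mathbb{R})$ is the group of real $2d\times 2d$ matrices with $d\times d$ blocks $\begin{pmatrix}A&B\\C&D\end{pmatrix}$ satisfying $A^TC=C^TA$, $B^TD=D^TB$, $A^TD-C^TB=I$. $R(C)$ denotes the range of $C$. Metaplectic operators. For $(x,\xi;\tau)\in\mathbb{R}^d\times\mathbb{R}^d\times\mathbb{R}$ and $f\in L^2(\mathbb{R}^d)$ let $\rho(x,\xi;\tau)f(t)=e^{2\pi i\tau}e^{-i\pi x\cdot\xi}e^{2\pi i\xi\cdot t}f(t-x)$. A metaplectic operator with projection $S$ is a unitary operator $\hat S$ on $L^2(\mathbb{R}^d)$ with $\hat S\rho(x,\xi;\tau)\hat S^{-1}=\rho(S(x,\xi);\tau)$ for all $(x,\xi;\tau)$; it exists and is unique up to a phase factor (a complex constant of modulus $1$). $\hat S$ maps $\mathcal{S}(\mathbb{R}^d)$ to $\mathcal{S}(\mathbb{R}^d)$ continuously. Schwartz kernel. The kernel of a continuous linear $T:\mathcal{S}(\mathbb{R}^d)\to\mathcal{S}'(\mathbb{R}^d)$ is the distribution $k\in\mathcal{S}'(\mathbb{R}^{2d})$ such that, formally, $Tf(x)=\int_{\mathbb{R}^d}k(x,y)f(y)\,dy$ for $f\in\mathcal{S}(\mathbb{R}^d)$. Terminology. "$\tilde k$ decays off (equivalently, is localized on) a manifold $\Gamma$" means: $|\tilde k(x,y)|=c\,e^{-\pi\mathcal{Q}_S(x,y)}$ with $c>0$ and $\mathcal{Q}_S$ a positive semi-definite quadratic form whose zero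 set is $\Gamma$. *)

theory Defs
  imports "HOL-Analysis.Analysis"
begin

section \<open>Schwartz functions and tempered distributions\<close>

text \<open>Multi-indices are encoded as lists of basis vectors; the entries of the list are the
  successive directions of differentiation.\<close>

definition iter_deriv :: "'a::euclidean_space list \<Rightarrow> ('a \<Rightarrow> complex) \<Rightarrow> 'a \<Rightarrow> complex" where
  "iter_deriv bs f = foldr (\<lambda>b g x. frechet_derivative g (at x) b) bs f"

definition schwartz :: "('a::euclidean_space \<Rightarrow> complex) set" where
  "schwartz = {f. \<forall>bs\<in>lists Basis.
     (\<forall>x. iter_deriv bs f differentiable at x) \<and>
     (\<forall>N. bounded (range (\<lambda>x. (1 + norm x) ^ N * norm (iter_deriv bs f x))))}"

definition schwartz_seminorm ::
    "nat \<Rightarrow> 'a::euclidean_space list \<Rightarrow> ('a \<Rightarrow> complex) \<Rightarrow> real" where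
  "schwartz_seminorm N bs f = (SUP x. (1 + norm x) ^ N * norm (iter_deriv bs f x))"

definition schwartz_topology :: "('a::euclidean_space \<Rightarrow> complex) topology" where
  "schwartz_topology = topology_generated_by
     {{g \<in> schwartz. schwartz_seminorm N bs (\<lambda>x. g x - f x) < e} | f N bs e.
        f \<in> schwartz \<and> bs \<in> lists Basis \<and> e > 0}"

text \<open>Only the values on Schwartz functions are meaningful.\<close>

definition tempered_distribution ::
    "(('a::euclidean_space \<Rightarrow> complex) \<Rightarrow> complex) \<Rightarrow> bool" where
  "tempered_distribution u \<longleftrightarrow>
     (\<forall>f\<in>schwartz. \<forall>g\<in>schwartz. u (\<lambda>x. f x + g x) = u f + u g) \<and>
     (\<forall>c. \<forall>f\<in>schwartz. u (\<lambda>x. c * f x) = c * u f) \<and>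
     continuous_map schwartz_topology euclidean u"

text \<open>\<open>k\<close> is the kernel of \<open>T : S \<rightarrow> S'\<close>: formally, \<open>T f x = \<integral> k (x, y) f y dy\<close>,
  that is, \<open>\<langle>T f, g\<rangle> = \<langle>k, g \<otimes> f\<rangle>\<close> (bilinear pairings, no conjugation).\<close>

definition schwartz_kernel ::
    "(('a::euclidean_space \<Rightarrow> complex) \<Rightarrow> ('b::euclidean_space \<Rightarrow> complex) \<Rightarrow> complex) \<Rightarrow>
     (('b \<times> 'a \<Rightarrow> complex) \<Rightarrow> complex) \<Rightarrow> bool" where
  "schwartz_kernel T k \<longleftrightarrow> tempered_distribution k \<and>
     (\<forall>f\<in>schwartz. \<forall>g\<in>schwartz. k (\<lambda>(x, y). g x * f y) = T f g)"

definition conv_dist ::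
    "(('a::euclidean_space \<Rightarrow> complex) \<Rightarrow> complex) \<Rightarrow> ('a \<Rightarrow> complex) \<Rightarrow> 'a \<Rightarrow> complex" where
  "conv_dist u \<phi> z = u (\<lambda>w. \<phi> (z - w))"

definition gaussian :: "'a::euclidean_space \<Rightarrow> complex" where
  "gaussian t = complex_of_real (exp (- pi * (norm t)\<^sup>2))"


section \<open>The Hilbert space of square-integrable functions\<close>

definition square_integrable :: "('a::euclidean_space \<Rightarrow> complex) \<Rightarrow> bool" where
  "square_integrable f \<longleftrightarrow>
     f \<in> borel_measurable lborel \<and> integrable lborel (\<lambda>x. (norm (f x))\<^sup>2)"

definition l2_rel ::
    "('a::euclidean_space \<Rightarrow> complex) \<Rightarrow> ('a \<Rightarrow> complex) \<Rightarrow> bool" where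
  "l2_rel f g \<longleftrightarrow> square_integrable f \<and> square_integrable g \<and> (AE x in lborel. f x = g x)"

quotient_type (overloaded) 'a l2 = "'a::euclidean_space \<Rightarrow> complex" / partial: l2_rel
proof (rule part_equivpI)
  show "\<exists>f::'a \<Rightarrow> complex. l2_rel f f"
    by (rule exI[of _ "\<lambda>_. 0"]) (simp add: l2_rel_def square_integrable_def)
  show "symp (l2_rel :: ('a \<Rightarrow> complex) \<Rightarrow> _)"
    by (auto simp: symp_def l2_rel_def elim!: AE_mp)
  show "transp (l2_rel :: ('a \<Rightarrow> complex) \<Rightarrow> _)"
    by (auto simp: transp_def l2_rel_def elim: AE_mp[where P="\<lambda>x. _ x = _ x"])
qed

lemma square_integrable_add:
  assumes "square_integrable f" "square_integrable g"
  shows "square_integrable (\<lambda>x. f x + g x)"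
proof -
  have [measurable]: "f \<in> borel_measurable lborel" "g \<in> borel_measurable lborel"
    using assms by (auto simp: square_integrable_def)
  have int: "integrable lborel (\<lambda>x. 2 * (norm (f x))\<^sup>2 + 2 * (norm (g x))\<^sup>2)"
    using assms by (auto simp: square_integrable_def)
  have bnd: "(norm (f x + g x))\<^sup>2 \<le> 2 * (norm (f x))\<^sup>2 + 2 * (norm (g x))\<^sup>2" for x
  proof -
    have "(norm (f x + g x))\<^sup>2 \<le> (norm (f x) + norm (g x))\<^sup>2"
      by (intro power_mono norm_triangle_ineq) auto
    also have "\<dots> \<le> 2 * (norm (f x))\<^sup>2 + 2 * (norm (g x))\<^sup>2"
      using sum_squares_ge_zero[of "norm (f x) - norm (g x)" 0]
      by (simp add: power2_eq_square algebra_simps)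
    finally show ?thesis .
  qed
  have "integrable lborel (\<lambda>x. (norm (f x + g x))\<^sup>2)"
    by (rule Bochner_Integration.integrable_bound[OF int]) (use bnd in auto)
  then show ?thesis by (simp add: square_integrable_def)
qed

lift_definition l2_add :: "'a::euclidean_space l2 \<Rightarrow> 'a l2 \<Rightarrow> 'a l2"
  is "\<lambda>f g x. f x + g x"
  by (auto simp: l2_rel_def square_integrable_add)

lift_definition l2_scale :: "complex \<Rightarrow> 'a::euclidean_space l2 \<Rightarrow> 'a l2"
  is "\<lambda>c f x. c * f x"
  by (auto simp: l2_rel_def square_integrable_def norm_mult power_mult_distrib)

lift_definition l2_inner :: "'a::euclidean_space l2 \<Rightarrow> 'a l2 \<Rightarrow> complex"
  is "\<lambda>f g. LINT x|lborel. f x * cnj (g x)"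
  by (rule integral_cong_AE)
    (auto simp: l2_rel_def square_integrable_def intro!: borel_measurable_times
      measurable_compose[OF _ borel_measurable_continuous_onI[of cnj]] continuous_intros)

lemma square_integrable_shift:
  assumes "square_integrable f"
  shows "square_integrable (\<lambda>t. f (t - a))"
proof -
  have [measurable]: "f \<in> borel_measurable lborel"
    using assms by (auto simp: square_integrable_def)
  have "integrable (distr lborel borel ((+) (- a))) (\<lambda>x. (norm (f x))\<^sup>2)"
    using assms by (auto simp: square_integrable_def lborel_distr_plus)
  then have "integrable lborel (\<lambda>x. (norm (f (- a + x)))\<^sup>2)"
    by (subst (asm) integrable_distr_eq) auto
  then show ?thesis by (simp add: square_integrable_def)
qed

lemma AE_lborel_shift:
  fixes a :: "'a::euclidean_space"
  assumes "AE x in lborel. P x"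
  shows "AE x in lborel. P (x - a)"
proof -
  have "AE x in distr lborel borel ((+) (- a)). P x"
    unfolding lborel_distr_plus by (rule assms)
  then have "AE x in lborel. P (- a + x)"
    by (rule AE_distrD[rotated]) simp
  then show ?thesis by simp
qed

lemma square_integrable_unimodular:
  assumes "square_integrable f" and "m \<in> borel_measurable lborel" and "\<And>t. norm (m t) = 1"
  shows "square_integrable (\<lambda>t. m t * f t)"
  using assms by (auto simp: square_integrable_def norm_mult intro!: borel_measurable_times)

definition unitary :: "('a::euclidean_space l2 \<Rightarrow> 'a l2) \<Rightarrow> bool" where
  "unitary U \<longleftrightarrow>
     (\<forall>f g. U (l2_add f g) = l2_add (U f) (U g)) \<and>
     (\<forall>c f. U (l2_scale c f) = l2_scale c (U f)) \<and>
     (\<forall>f g. l2_inner (U f) (U g) = l2_inner f g) \<and>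
     surj U"


section \<open>Symplectic matrices and metaplectic operators\<close>

definition symplectic ::
    "real^'n^'n \<Rightarrow> real^'n^'n \<Rightarrow> real^'n^'n \<Rightarrow> real^'n^'n \<Rightarrow> bool" where
  "symplectic A B C D \<longleftrightarrow>
     transpose A ** C = transpose C ** A \<and>
     transpose B ** D = transpose D ** B \<and>
     transpose A ** D - transpose C ** B = mat 1"

definition block_apply ::
    "real^'n^'n \<Rightarrow> real^'n^'n \<Rightarrow> real^'n^'n \<Rightarrow> real^'n^'n \<Rightarrow>
     (real^'n) \<times> (real^'n) \<Rightarrow> (real^'n) \<times> (real^'n)" where
  "block_apply A B C D = (\<lambda>(x, \<xi>). (A *v x + B *v \<xi>, C *v x + D *v \<xi>))"

lift_definition rho :: "(real^'n) \<times> (real^'n) \<Rightarrow> real \<Rightarrow> (real^'n) l2 \<Rightarrow> (real^'n) l2"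
  is "\<lambda>(x, \<xi>) (\<tau>::real) f t. exp (2 * pi * \<i> * \<tau>) * exp (- \<i> * pi * (x \<bullet> \<xi>)) *
        exp (2 * pi * \<i> * (\<xi> \<bullet> t)) * f (t - x)"
proof -
  fix z :: "(real^'n) \<times> (real^'n)" and \<tau> :: real and f g :: "real^'n \<Rightarrow> complex"
  assume fg: "l2_rel f g"
  obtain x \<xi> where z: "z = (x, \<xi>)" by fastforce
  let ?m = "\<lambda>t. exp (2 * pi * \<i> * \<tau>) * exp (- \<i> * pi * (x \<bullet> \<xi>)) * exp (2 * pi * \<i> * (\<xi> \<bullet> t))"
  have sq: "square_integrable (\<lambda>t. ?m t * h (t - x))" if "square_integrable h" for h
    using square_integrable_shift[OF that]
    by (rule square_integrable_unimodular) (auto simp: norm_mult)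
  have "AE t in lborel. f (t - x) = g (t - x)"
    using fg by (intro AE_lborel_shift) (simp add: l2_rel_def)
  then show "l2_rel ((case z of (x, \<xi>) \<Rightarrow> \<lambda>(\<tau>::real) f t. exp (2 * pi * \<i> * \<tau>) *
      exp (- \<i> * pi * (x \<bullet> \<xi>)) * exp (2 * pi * \<i> * (\<xi> \<bullet> t)) * f (t - x)) \<tau> f)
     ((case z of (x, \<xi>) \<Rightarrow> \<lambda>(\<tau>::real) f t. exp (2 * pi * \<i> * \<tau>) *
      exp (- \<i> * pi * (x \<bullet> \<xi>)) * exp (2 * pi * \<i> * (\<xi> \<bullet> t)) * f (t - x)) \<tau> g)"
    using fg sq by (auto simp: l2_rel_def z)
qed

definition metaplectic ::
    "((real^'n) \<times> (real^'n) \<Rightarrow> (real^'n) \<times> (real^'n)) \<Rightarrow>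
     ((real^'n) l2 \<Rightarrow> (real^'n) l2) \<Rightarrow> bool" where
  "metaplectic S U \<longleftrightarrow> unitary U \<and> (\<forall>z \<tau>. U \<circ> rho z \<tau> \<circ> inv U = rho (S z) \<tau>)"

text \<open>The restriction to Schwartz functions of an operator on the space of square-integrable
  functions, with values regarded as distributions: \<open>\<langle>U f, g\<rangle> = \<integral> (U f)(x) g(x) dx\<close>.\<close>

definition op_dist ::
    "('a::euclidean_space l2 \<Rightarrow> 'a l2) \<Rightarrow> ('a \<Rightarrow> complex) \<Rightarrow> ('a \<Rightarrow> complex) \<Rightarrow> complex" where
  "op_dist U f g = (LINT x|lborel. rep_l2 (U (abs_l2 f)) x * g x)"


section \<open>Quadratic forms\<close>

definition psd_quadratic_form :: "('a::real_vector \<Rightarrow> real) \<Rightarrow> bool" where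
  "psd_quadratic_form Q \<longleftrightarrow> (\<exists>h. bilinear h \<and> Q = (\<lambda>z. h z z)) \<and> (\<forall>z. 0 \<le> Q z)"

end

theory Submission
  imports Defs "HOL-Probability.Distributions"
begin

text \<open>Write \<open>\<phi>\<close> for the Gaussian and \<open>F z = \<langle>U \<phi>, \<rho> z \<phi>\<rangle>\<close>. Testing the kernel against translated Gaussians and
  moving \<open>\<rho>\<close> across \<open>U\<close> gives \<open>\<bar>k * \<phi>\<bar> (x, y) = \<bar>F ((x, 0) - S (y, 0))\<bar>\<close>. Up to a Gaussian factor \<open>F\<close> is a
  Bargmann transform, hence satisfies Cauchy--Riemann equations for the standard complex structure \<open>J\<close>.
  Intertwining with \<open>U\<close> yields conjugate equations for the structure \<open>S J S\<^sup>-\<^sup>1\<close>. Adding the two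
  systems determines the full derivative of \<open>F\<close>, since \<open>J + S J S\<^sup>-\<^sup>1 = (1 + S S\<^sup>T) J\<close> is invertible, and
  integrating it gives \<open>\<bar>F z\<bar> = \<bar>F 0\<bar> exp (- \<pi> z \<bullet> (1 + S S\<^sup>T)\<^sup>-\<^sup>1 z)\<close>. Here \<open>F 0 \<noteq> 0\<close> because otherwise \<open>F = 0\<close>,
  and then \<open>U \<phi> = 0\<close> by uniqueness of Fourier transforms. The quadratic form vanishes exactly when
  \<open>(x, 0) = S (y, 0)\<close>.\<close>


section \<open>Uniqueness of Fourier transforms of integrable functions\<close>

text \<open>Polynomials in \<open>sin (a t\<^sub>i)\<close> are trigonometric polynomials, so they integrate to zero against a function with vanishing
  Fourier transform. By Stone--Weierstrass on the unit cube, so does \<open>F (sin (a t\<^sub>1) / a, \<dots>)\<close> for every continuous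
  \<open>F\<close>, and \<open>a \<rightarrow> 0\<close> recovers \<open>F\<close> itself.\<close>

definition fourier_null :: "('a::euclidean_space \<Rightarrow> complex) \<Rightarrow> bool" where
  "fourier_null u \<longleftrightarrow> integrable lborel u \<and>
     (\<forall>\<xi>. (LINT t|lborel. exp (\<i> * complex_of_real (\<xi> \<bullet> t)) * u t) = 0)"

lemma integrable_bounded_mult:
  fixes u m :: "'a::euclidean_space \<Rightarrow> complex"
  assumes "integrable lborel u" "m \<in> borel_measurable borel" "\<And>t. norm (m t) \<le> c"
  shows "integrable lborel (\<lambda>t. m t * u t)"
proof (rule Bochner_Integration.integrable_bound)
  show "integrable lborel (\<lambda>t. c * norm (u t))"
    using assms by auto
  show "(\<lambda>t. m t * u t) \<in> borel_measurable lborel"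
    using assms by (auto intro!: borel_measurable_times)
  have "norm (m t * u t) \<le> norm (c * norm (u t))" for t
    using mult_right_mono[OF order_trans[OF assms(3) abs_ge_self], of "norm (u t)" t]
    by (simp add: norm_mult abs_mult)
  then show "AE t in lborel. norm (m t * u t) \<le> norm (c * norm (u t))" by simp
qed

lemma integrable_exp_mult:
  fixes u :: "'a::euclidean_space \<Rightarrow> complex"
  assumes "integrable lborel u"
  shows "integrable lborel (\<lambda>t. exp (\<i> * complex_of_real (\<xi> \<bullet> t)) * u t)"
  by (rule integrable_bounded_mult[OF assms, where c = 1])
    (auto intro!: borel_measurable_continuous_onI continuous_intros)

lemma fourier_null_add:
  assumes "fourier_null u" "fourier_null v"
  shows "fourier_null (\<lambda>t. u t + v t)"
proof -
  have *: "integrable lborel (\<lambda>t. exp (\<i> * complex_of_real (\<xi> \<bullet> t)) * u t)"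
       "integrable lborel (\<lambda>t. exp (\<i> * complex_of_real (\<xi> \<bullet> t)) * v t)" for \<xi>
    using assms by (auto simp: fourier_null_def intro!: integrable_exp_mult)
  show ?thesis
    using assms Bochner_Integration.integral_add[OF *]
    by (auto simp: fourier_null_def distrib_left)
qed

lemma fourier_null_mult_const:
  assumes "fourier_null u" shows "fourier_null (\<lambda>t. c * u t)"
  using assms by (auto simp: fourier_null_def mult.left_commute)

lemma fourier_null_sum:
  assumes "finite I" "\<And>i. i \<in> I \<Longrightarrow> fourier_null (u i)"
  shows "fourier_null (\<lambda>t. \<Sum>i\<in>I. u i t)"
  using assms
  by (induction) (auto intro!: fourier_null_add simp: fourier_null_def[of "\<lambda>t. 0"])

text \<open>Multiplication by a character translates the Fourier transform by \<open>a\<close>, and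
  a translate of zero is zero.\<close>

lemma fourier_null_mult_exp:
  assumes "fourier_null u"
  shows "fourier_null (\<lambda>t. exp (\<i> * complex_of_real (a \<bullet> t)) * u t)"
proof -
  have "exp (\<i> * complex_of_real (\<xi> \<bullet> t)) * (exp (\<i> * complex_of_real (a \<bullet> t)) * u t)
      = exp (\<i> * complex_of_real ((\<xi> + a) \<bullet> t)) * u t" for \<xi> t
    by (simp add: inner_add_left distrib_left exp_add)
  then show ?thesis using assms
    by (simp only: fourier_null_def integrable_exp_mult) simp
qed

lemma fourier_null_mult_sin:
  assumes "fourier_null u"
  shows "fourier_null (\<lambda>t. complex_of_real (sin (a \<bullet> t)) * u t)"
proof -
  have "complex_of_real (sin (a \<bullet> t)) * u t =
      (1 / (2 * \<i>)) * (exp (\<i> * complex_of_real (a \<bullet> t)) * u t) +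
      (- 1 / (2 * \<i>)) * (exp (\<i> * complex_of_real ((- a) \<bullet> t)) * u t)" for t
    unfolding sin_of_real[symmetric] by (simp add: sin_exp_eq field_simps)
  then show ?thesis
    by (simp only:) (intro fourier_null_add fourier_null_mult_const fourier_null_mult_exp assms)
qed

text \<open>The coordinatewise sine stays in a compact cube, where Weierstrass approximation is
  uniform, while \<open>(1 / a) *\<^sub>R sin_vec a t\<close> tends to \<open>t\<close> as
  \<open>a\<close> tends to 0.\<close>

definition sin_vec :: "real \<Rightarrow> 'a::euclidean_space \<Rightarrow> 'a" where
  "sin_vec a t = (\<Sum>b\<in>Basis. sin (a * (t \<bullet> b)) *\<^sub>R b)"

text \<open>The induction keeps \<open>u\<close> arbitrary: for a product, the hypothesis for
  \<open>f\<close> is applied to the null function in which \<open>u\<close> has already absorbed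
  the factor \<open>g\<close>. A linear \<open>f\<close> gives a combination of sines of single
  coordinates.\<close>

lemma fourier_null_mult_polynomial_sin:
  assumes "real_polynomial_function p" "fourier_null u"
  shows "fourier_null (\<lambda>t. complex_of_real (p (sin_vec a t)) * u t)"
  using assms
proof (induction p arbitrary: u rule: real_polynomial_function.induct)
  case (linear f)
  interpret bounded_linear f by fact
  have "complex_of_real (f (sin_vec a t)) * u t =
     (\<Sum>b\<in>Basis. complex_of_real (f b) * (complex_of_real (sin ((a *\<^sub>R b) \<bullet> t)) * u t))" for t
    by (simp add: sin_vec_def sum scaleR sum_distrib_right inner_commute mult.assoc mult.left_commute)
  then show ?case
    by (simp only:) (intro fourier_null_sum fourier_null_mult_const fourier_null_mult_sin linear.prems finite_Basis)
next
  case (const c)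
  then show ?case by (intro fourier_null_mult_const)
next
  case (add f g)
  then show ?case by (simp add: distrib_right fourier_null_add)
next
  case (mult f g)
  then show ?case by (simp add: mult.assoc)
qed

lemma continuous_on_sin_vec: "continuous_on S (sin_vec a)"
  unfolding sin_vec_def by (intro continuous_intros)

text \<open>A polynomial within \<open>e\<close> of \<open>F\<close> on the cube contributes 0, so
  the integral is at most \<open>e\<close> times the L1 norm of \<open>u\<close>, for every
  \<open>e > 0\<close>.\<close>

lemma integral_continuous_sin_fourier_null:
  fixes F :: "'a::euclidean_space \<Rightarrow> real"
  assumes u: "fourier_null u" and F: "continuous_on UNIV F"
  shows "(LINT t|lborel. complex_of_real (F (sin_vec a t)) * u t) = 0"
proof -
  define N where "N = (LINT t|lborel. norm (u t))"
  let ?K = "cbox (- One) One :: 'a set"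
  have K: "sin_vec a t \<in> ?K" for t :: 'a
    by (auto simp: sin_vec_def mem_box)
  have ui: "integrable lborel u" using u by (simp add: fourier_null_def)
  have "norm (LINT t|lborel. complex_of_real (F (sin_vec a t)) * u t) \<le> e * N" if e: "e > 0" for e
  proof -
    obtain p where p: "real_polynomial_function p" and pF: "\<And>x. x \<in> ?K \<Longrightarrow> \<bar>F x - p x\<bar> < e"
      by (rule Stone_Weierstrass_real_polynomial_function[of ?K F e])
        (use e F in \<open>auto intro: continuous_on_subset\<close>)
    have np: "fourier_null (\<lambda>t. complex_of_real (p (sin_vec a t)) * u t)"
      by (rule fourier_null_mult_polynomial_sin[OF p u])
    \<comment> \<open>The Fourier transform at frequency 0 is the plain integral.\<close>
    have ip: "integrable lborel (\<lambda>t. complex_of_real (p (sin_vec a t)) * u t)"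
      and zp: "(LINT t|lborel. complex_of_real (p (sin_vec a t)) * u t) = 0"
      using np by (auto simp: fourier_null_def dest: spec[of _ 0])
    have pc: "continuous_on UNIV p"
      using p continuous_on_polymonial_function real_polynomial_function_eq by blast
    have m: "(\<lambda>t. complex_of_real (F (sin_vec a t) - p (sin_vec a t))) \<in> borel_measurable borel"
      by (intro borel_measurable_continuous_onI continuous_intros
            continuous_on_compose2[OF F continuous_on_sin_vec]
            continuous_on_compose2[OF pc continuous_on_sin_vec]) auto
    have le: "norm (complex_of_real (F (sin_vec a t) - p (sin_vec a t))) \<le> e" for t
      using pF[OF K, of t] by (simp only: norm_of_real)
    have id: "integrable lborel (\<lambda>t. complex_of_real (F (sin_vec a t) - p (sin_vec a t)) * u t)"
      by (rule integrable_bounded_mult[OF ui m le])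
    have "(LINT t|lborel. complex_of_real (F (sin_vec a t)) * u t) =
       (LINT t|lborel. complex_of_real (F (sin_vec a t) - p (sin_vec a t)) * u t +
          complex_of_real (p (sin_vec a t)) * u t)"
      by (intro Bochner_Integration.integral_cong) (auto simp: algebra_simps)
    also have "\<dots> = (LINT t|lborel. complex_of_real (F (sin_vec a t) - p (sin_vec a t)) * u t)"
      by (subst Bochner_Integration.integral_add[OF id ip]) (simp add: zp)
    also have "norm \<dots> \<le> (LINT t|lborel. norm (complex_of_real (F (sin_vec a t) - p (sin_vec a t)) * u t))"
      by (rule integral_norm_bound)
    also have "\<dots> \<le> (LINT t|lborel. e * norm (u t))"
    proof (rule integral_mono)
      show "norm (complex_of_real (F (sin_vec a t) - p (sin_vec a t)) * u t) \<le> e * norm (u t)" for t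
        using mult_right_mono[OF le norm_ge_zero] by (simp only: norm_mult)
    qed (use ui id in auto)
    finally show ?thesis by (simp add: N_def)
  qed
  then have *: "norm (LINT t|lborel. complex_of_real (F (sin_vec a t)) * u t) \<le> e * N" if "e > 0" for e
    using that by blast
  have "((\<lambda>e. e * N) \<longlongrightarrow> 0 * N) (at_right 0)"
    by (intro tendsto_intros)
  then have "norm (LINT t|lborel. complex_of_real (F (sin_vec a t)) * u t) \<le> 0 * N"
    by (rule tendsto_lowerbound[OF _ eventually_mono[OF eventually_at_right_less *]]) simp_all
  then show ?thesis by simp
qed

text \<open>In each coordinate this is the derivative of \<open>sin (x * s)\<close> at
  \<open>x = 0\<close>, sampled along \<open>1 / Suc n\<close>.\<close>

lemma sin_vec_tendsto: "(\<lambda>n. real (Suc n) *\<^sub>R sin_vec (1 / real (Suc n)) t) \<longlonglongrightarrow> t"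
proof -
  have "(\<lambda>n. real (Suc n) * sin (1 / real (Suc n) * s)) \<longlonglongrightarrow> s" for s :: real
  proof -
    have "((\<lambda>x. sin (x * s)) has_field_derivative s) (at 0)"
      by (auto intro!: derivative_eq_intros)
    then have "((\<lambda>h. sin (h * s) / h) \<longlongrightarrow> s) (at 0)"
      by (simp add: DERIV_def)
    moreover have "filterlim (\<lambda>n. 1 / real (Suc n)) (at 0) sequentially"
      using LIMSEQ_inverse_real_of_nat by (auto simp: filterlim_at inverse_eq_divide)
    ultimately have "(\<lambda>n. sin (1 / real (Suc n) * s) / (1 / real (Suc n))) \<longlonglongrightarrow> s"
      by (rule filterlim_compose)
    then show ?thesis by (simp add: mult.commute)
  qed
  then have "(\<lambda>n. \<Sum>b\<in>Basis. (real (Suc n) * sin (1 / real (Suc n) * (t \<bullet> b))) *\<^sub>R b)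
      \<longlonglongrightarrow> (\<Sum>b\<in>Basis. (t \<bullet> b) *\<^sub>R b)"
    by (intro tendsto_intros)
  then show ?thesis by (simp add: sin_vec_def scaleR_sum_right euclidean_representation)
qed

text \<open>Boundedness of \<open>F\<close> supplies the dominating function
  \<open>c * norm (u t)\<close>, so the limit of the rescaled sines can be taken inside the
  integral.\<close>

lemma integral_bounded_continuous_fourier_null:
  fixes F :: "'a::euclidean_space \<Rightarrow> real"
  assumes u: "fourier_null u" and F: "continuous_on UNIV F" and le: "\<And>t. \<bar>F t\<bar> \<le> c"
  shows "(LINT t|lborel. complex_of_real (F t) * u t) = 0"
proof -
  let ?S = "\<lambda>n t. real (Suc n) *\<^sub>R sin_vec (1 / real (Suc n)) t"
  have ui: "integrable lborel u" using u by (simp add: fourier_null_def)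
  have um [measurable]: "u \<in> borel_measurable borel" using borel_measurable_integrable[OF ui] by simp
  have c: "continuous_on UNIV (\<lambda>x. F (real (Suc n) *\<^sub>R x))" for n
    by (intro continuous_on_compose2[OF F] continuous_intros) auto
  have [measurable]: "F \<in> borel_measurable borel" 
    by (intro borel_measurable_continuous_onI F)
  have [measurable]: "(\<lambda>t. F (?S n t)) \<in> borel_measurable borel" for n
    by (intro borel_measurable_continuous_onI continuous_on_compose2[OF c continuous_on_sin_vec]) auto
  have "(\<lambda>n. LINT t|lborel. complex_of_real (F (?S n t)) * u t)
      \<longlonglongrightarrow> (LINT t|lborel. complex_of_real (F t) * u t)"
  proof (rule integral_dominated_convergence)
    show "integrable lborel (\<lambda>t. c * norm (u t))" using ui by auto
    have "(\<lambda>n. F (?S n t)) \<longlonglongrightarrow> F t" for t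
      by (rule isCont_tendsto_compose[OF _ sin_vec_tendsto])
        (use F in \<open>simp add: continuous_on_eq_continuous_at\<close>)
    then show "AE t in lborel. (\<lambda>n. complex_of_real (F (?S n t)) * u t) \<longlonglongrightarrow> complex_of_real (F t) * u t"
      by (intro AE_I2 tendsto_intros)
    show "AE t in lborel. norm (complex_of_real (F (?S n t)) * u t) \<le> c * norm (u t)" for n
      by (intro AE_I2) (use le in \<open>auto simp: norm_mult intro!: mult_right_mono\<close>)
  qed measurable
  \<comment> \<open>Every term of the sequence vanishes, by the preceding result for the continuous
    function that sends \<open>x\<close> to \<open>F (real (Suc n) *\<^sub>R x)\<close>.\<close>
  then show ?thesis
    using integral_continuous_sin_fourier_null[OF u c]
    by (simp add: LIMSEQ_const_iff)
qed

text \<open>The indicator of \<open>K\<close> is the pointwise limit of continuous cutoffs with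
  values between 0 and 1. Closedness makes the distance to \<open>K\<close> positive off
  \<open>K\<close>, so there the cutoffs are eventually exactly 0.\<close>

lemma integral_closed_fourier_null:
  assumes u: "fourier_null u" and K: "closed K"
  shows "(LINT t:K|lborel. u t) = 0"
proof (cases "K = {}")
  case False
  let ?F = "\<lambda>n t. max 0 (1 - real n * infdist t K)"
  have ui: "integrable lborel u" using u by (simp add: fourier_null_def)
  have um [measurable]: "u \<in> borel_measurable borel" using borel_measurable_integrable[OF ui] by simp
  have [measurable]: "K \<in> sets borel" using K by simp
  have cF: "continuous_on UNIV (?F n)" for n
    by (intro continuous_intros continuous_on_max) 
  have [measurable]: "?F n \<in> borel_measurable borel" for n
    by (intro borel_measurable_continuous_onI cF)
  have [measurable]: "(\<lambda>t. infdist t K) \<in> borel_measurable borel"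
    by (intro borel_measurable_continuous_onI continuous_intros)
  have "(\<lambda>n. LINT t|lborel. complex_of_real (?F n t) * u t)
      \<longlonglongrightarrow> (LINT t|lborel. complex_of_real (indicator K t) * u t)"
  proof (rule integral_dominated_convergence)
    show "integrable lborel (\<lambda>t. norm (u t))" using ui by auto
    have "(\<lambda>n. ?F n t) \<longlonglongrightarrow> indicator K t" for t
    proof (cases "t \<in> K")
      case False
      then have d: "infdist t K > 0"
        using K \<open>K \<noteq> {}\<close> by (metis in_closed_iff_infdist_zero infdist_nonneg order_le_less)
      have "\<forall>\<^sub>F n in sequentially. real n > 1 / infdist t K"
        using filterlim_real_sequentially by (auto simp: filterlim_at_top_dense)
      then have "\<forall>\<^sub>F n in sequentially. ?F n t = indicator K t"
        by eventually_elim (use d False in \<open>simp add: divide_less_eq\<close>)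
      then show ?thesis by (rule tendsto_eventually)
    qed simp
    then show "AE t in lborel. (\<lambda>n. complex_of_real (?F n t) * u t) \<longlonglongrightarrow> complex_of_real (indicator K t) * u t"
      by (intro AE_I2 tendsto_intros)
    show "AE t in lborel. norm (complex_of_real (?F n t) * u t) \<le> norm (u t)" for n
      by (intro AE_I2) (auto simp: norm_mult infdist_nonneg intro!: mult_left_le_one_le)
  qed measurable
  moreover have "(LINT t|lborel. complex_of_real (?F n t) * u t) = 0" for n
    by (rule integral_bounded_continuous_fourier_null[OF u cF, where c = 1]) (auto simp: infdist_nonneg)
  ultimately show ?thesis
    by (simp add: LIMSEQ_const_iff set_lebesgue_integral_def scaleR_conv_of_real)
qed (simp add: set_lebesgue_integral_def)

text \<open>Closed sets are an intersection-stable generator of the Borel sets, so the vanishing of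
  the integrals spreads from closed sets to all Borel sets by a Dynkin argument. A density with all
  set integrals zero is zero almost everywhere.\<close>

lemma fourier_null_AE_zero:
  fixes u :: "'a::euclidean_space \<Rightarrow> complex"
  assumes u: "fourier_null u"
  shows "AE t in lborel. u t = 0"
proof (rule sigma_finite_measure.density_unique_banach[OF lborel.sigma_finite_measure_axioms])
  show ui: "integrable lborel u" using u by (simp add: fourier_null_def)
  have si: "set_integrable lborel A u" if "A \<in> sets borel" for A
    using that ui by (metis integrable_mult_indicator set_integrable_def sets_lborel)
  have z: "(LINT t:UNIV|lborel. u t) = 0"
    by (rule integral_closed_fourier_null[OF u]) simp
  fix A :: "'a set"
  assume "A \<in> sets lborel"
  then have A: "A \<in> sigma_sets UNIV (Collect closed)"
    by (metis borel_eq_closed sets_lborel sets_measure_of_conv top_greatest Pow_UNIV)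
  have "Int_stable (Collect closed :: 'a set set)" by (auto simp: Int_stable_def)
  then have "A \<in> sets borel \<and> (LINT t:A|lborel. u t) = 0"
    using subset_UNIV[of "Collect closed", folded Pow_UNIV] A
  proof (induction A rule: sigma_sets_induct_disjoint)
    case (basic A)
    then show ?case using integral_closed_fourier_null[OF u] by auto
  next
    case (compl A)
    have "(LINT t:UNIV|lborel. u t) = (LINT t:A|lborel. u t) + (LINT t:UNIV - A|lborel. u t)"
      by (subst set_integral_Un[symmetric]) (use compl si in auto)
    then show ?case using compl z by auto
  next
    case (union A)
    have A: "(\<Union>i. A i) \<in> sets borel" using union by auto
    have "(LINT t:(\<Union>i. A i)|lborel. u t) = (\<Sum>i. (LINT t:A i|lborel. u t))"
      by (rule lebesgue_integral_countable_add)
        (use union si[OF A] in \<open>auto simp: disjoint_family_on_def\<close>)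
    then show ?case using union A by simp
  qed (auto simp: set_lebesgue_integral_def)
  then show "(LINT t:A|lborel. u t) = (LINT t:A|lborel. 0)"
    by (simp add: set_lebesgue_integral_def)
qed simp


section \<open>Gaussians and Bargmann integrals\<close>

lemma integrable_exp_neg_norm_square:
  assumes "c > 0"
  shows "integrable lborel (\<lambda>t::'a::euclidean_space. exp (- c * (norm t)\<^sup>2))"
proof (rule integrableI_bounded)
  \<comment> \<open>This standard deviation makes the normal density a multiple of
    \<open>exp (- c * s\<^sup>2)\<close>; the case of several dimensions follows as a product of
    one-dimensional integrals.\<close>
  define \<sigma> where "\<sigma> = 1 / sqrt (2 * c)"
  have "\<sigma> > 0" and \<sigma>: "2 * \<sigma>\<^sup>2 = 1 / c" using assms by (auto simp: \<sigma>_def power_divide)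
  have "integrable lborel (\<lambda>s. sqrt (2 * pi * \<sigma>\<^sup>2) * normal_density 0 \<sigma> s)"
    using \<open>\<sigma> > 0\<close> by simp
  moreover have "sqrt (2 * pi * \<sigma>\<^sup>2) * normal_density 0 \<sigma> s = exp (- c * s\<^sup>2)" for s
    using \<open>\<sigma> > 0\<close> by (simp add: normal_density_def \<sigma> mult.commute)
  ultimately have *: "(\<integral>\<^sup>+ s. ennreal (exp (- c * s\<^sup>2)) \<partial>lborel) < \<infinity>"
    by (simp add: integrable_iff_bounded)
  have sq: "(norm t)\<^sup>2 = (\<Sum>b\<in>Basis. (t \<bullet> b)\<^sup>2)" for t :: 'a
    by (subst power2_norm_eq_inner, subst euclidean_inner) (simp add: power2_eq_square)
  have "ennreal (exp (- c * (norm t)\<^sup>2)) = (\<Prod>b\<in>Basis. ennreal (exp (- c * (t \<bullet> b)\<^sup>2)))" for t :: 'a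
  proof -
    have "exp (- c * (norm t)\<^sup>2) = (\<Prod>b\<in>Basis. exp (- c * (t \<bullet> b)\<^sup>2))"
      unfolding sq by (simp add: exp_sum sum_distrib_left flip: sum_negf)
    then show ?thesis by (simp add: prod_ennreal)
  qed
  then have "(\<integral>\<^sup>+ (t::'a). ennreal (exp (- c * (norm t)\<^sup>2)) \<partial>lborel) =
      (\<Prod>b\<in>(Basis::'a set). (\<integral>\<^sup>+ s. ennreal (exp (- c * s\<^sup>2)) \<partial>lborel))"
    by (simp only:) (subst nn_integral_lborel_prod, auto)
  also have "\<dots> < \<infinity>"
    using * by (simp add: less_top[symmetric] power_eq_top_ennreal del: mult_minus_left)
  finally show "(\<integral>\<^sup>+ (t::'a). ennreal (norm (exp (- c * (norm t)\<^sup>2))) \<partial>lborel) < \<infinity>"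
    by simp
qed simp

text \<open>Completing the square costs one \<open>r\<^sup>2\<close>; since \<open>pi > 3\<close>,
  two of them remain for decay.\<close>

lemma exp_linear_gaussian_bound:
  assumes "r \<ge> 0"
  shows "exp (k * r) * exp (- pi * r\<^sup>2) \<le> exp (k\<^sup>2 / 4) * exp (- 2 * r\<^sup>2)"
proof -
  have "(k / 2 - r)\<^sup>2 \<ge> 0" by simp
  then have "k * r \<le> k\<^sup>2 / 4 + r\<^sup>2" by (simp add: power2_eq_square algebra_simps)
  moreover have "3 * r\<^sup>2 \<le> pi * r\<^sup>2" using pi_gt3 by (intro mult_right_mono) auto
  ultimately show ?thesis by (simp flip: exp_add)
qed

lemma norm_gaussian: "norm (gaussian t) = exp (- pi * (norm t)\<^sup>2)"
  by (simp add: gaussian_def)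

lemma continuous_on_gaussian: "continuous_on S gaussian"
  unfolding gaussian_def by (intro continuous_intros)

lemma borel_measurable_gaussian [measurable]: "gaussian \<in> borel_measurable borel"
  by (intro borel_measurable_continuous_onI continuous_on_gaussian)

lemma square_integrable_gaussian: "square_integrable (gaussian :: 'a::euclidean_space \<Rightarrow> complex)"
proof -
  have "(norm (gaussian t))\<^sup>2 = exp (- (2 * pi) * (norm t)\<^sup>2)" for t :: 'a
    by (simp add: norm_gaussian flip: exp_double)
  then show ?thesis
    using integrable_exp_neg_norm_square[of "2 * pi"] by (simp add: square_integrable_def)
qed

text \<open>The Gaussian absorbs the exponential weight, and
  \<open>X * Y \<le> X\<^sup>2 + Y\<^sup>2\<close> splits off the square-integrable factor. Having
  every \<open>k\<close> available is what later permits differentiation under the integral at every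
  point.\<close>

lemma integrable_square_integrable_gaussian:
  fixes f :: "'a::euclidean_space \<Rightarrow> complex"
  assumes "square_integrable f"
  shows "integrable lborel (\<lambda>t. norm (f t * gaussian t) * exp (k * norm t))"
proof (rule Bochner_Integration.integrable_bound)
  have [measurable]: "f \<in> borel_measurable borel" using assms by (simp add: square_integrable_def)
  show "integrable lborel (\<lambda>t. (norm (f t))\<^sup>2 + (exp (k\<^sup>2 / 4))\<^sup>2 * exp (- 4 * (norm t)\<^sup>2))"
    using assms integrable_exp_neg_norm_square[of 4] by (auto simp: square_integrable_def)
  have "norm (f t * gaussian t) * exp (k * norm t) \<le>
      (norm (f t))\<^sup>2 + (exp (k\<^sup>2 / 4))\<^sup>2 * exp (- 4 * (norm t)\<^sup>2)" for t
  proof -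
    define X Y where "X = norm (f t)" and "Y = exp (k\<^sup>2 / 4) * exp (- 2 * (norm t)\<^sup>2)"
    have "norm (f t * gaussian t) * exp (k * norm t) = X * (exp (k * norm t) * exp (- pi * (norm t)\<^sup>2))"
      by (simp add: X_def norm_mult norm_gaussian)
    also have "\<dots> \<le> X * Y"
      unfolding Y_def by (intro mult_left_mono exp_linear_gaussian_bound) (auto simp: X_def)
    also have "\<dots> \<le> X\<^sup>2 + Y\<^sup>2"
    proof -
      have "0 \<le> (X - Y)\<^sup>2 + X\<^sup>2 + Y\<^sup>2" by simp
      then show ?thesis by (simp add: power2_diff)
    qed
    also have "Y\<^sup>2 = (exp (k\<^sup>2 / 4))\<^sup>2 * exp (- 4 * (norm t)\<^sup>2)"
      by (simp add: Y_def power_mult_distrib flip: exp_double)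
    finally show ?thesis by (simp add: X_def)
  qed
  then show "AE t in lborel. norm (norm (f t * gaussian t) * exp (k * norm t)) \<le>
      norm ((norm (f t))\<^sup>2 + (exp (k\<^sup>2 / 4))\<^sup>2 * exp (- 4 * (norm t)\<^sup>2))"
    by (intro AE_I2) (smt (verit) real_norm_def zero_le_mult_iff norm_ge_zero exp_ge_zero)
qed (use assms in \<open>auto simp: square_integrable_def\<close>)

section \<open>Translated Gaussians are Schwartz functions\<close>

lemma real_polynomial_function_has_derivative:
  assumes "real_polynomial_function p"
  shows "\<exists>p'. (\<forall>x. (p has_derivative p' x) (at x)) \<and> (\<forall>v. real_polynomial_function (\<lambda>x. p' x v))"
  using assms
proof induction
  case (linear f)
  then show ?case
    by (intro exI[of _ "\<lambda>x. f"]) (auto intro: bounded_linear_imp_has_derivative)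
next
  case (const c)
  then show ?case by (intro exI[of _ "\<lambda>x v. 0"]) auto
next
  case (add f g)
  then obtain f' g' where "\<forall>x. (f has_derivative f' x) (at x)" "\<forall>v. real_polynomial_function (\<lambda>x. f' x v)"
    "\<forall>x. (g has_derivative g' x) (at x)" "\<forall>v. real_polynomial_function (\<lambda>x. g' x v)" by auto
  then show ?case
    by (intro exI[of _ "\<lambda>x v. f' x v + g' x v"]) (auto intro!: has_derivative_add)
next
  case (mult f g)
  then obtain f' g' where "\<forall>x. (f has_derivative f' x) (at x)" "\<forall>v. real_polynomial_function (\<lambda>x. f' x v)"
    "\<forall>x. (g has_derivative g' x) (at x)" "\<forall>v. real_polynomial_function (\<lambda>x. g' x v)" by auto
  then show ?case using mult.hyps
    by (intro exI[of _ "\<lambda>x v. f x * g' x v + f' x v * g x"])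
      (auto intro!: has_derivative_mult real_polynomial_function.intros(3,4))
qed

lemma real_polynomial_function_growth:
  assumes "real_polynomial_function p"
  shows "\<exists>C m. \<forall>x. \<bar>p x\<bar> \<le> C * (1 + norm x) ^ m"
  using assms
proof induction
  case (linear f)
  then obtain K where K: "\<And>x. norm (f x) \<le> norm x * K" "K \<ge> 0"
    using bounded_linear.nonneg_bounded by blast
  have "norm x * K \<le> K * (1 + norm x) ^ 1" for x
    using \<open>K \<ge> 0\<close> by (simp add: distrib_left mult.commute)
  then have "\<bar>f x\<bar> \<le> K * (1 + norm x) ^ 1" for x
    using K(1)[of x] by (metis order_trans real_norm_def)
  then show ?case by blast
next
  case (const c)
  have "\<bar>c\<bar> \<le> \<bar>c\<bar> * (1 + norm x) ^ 0" for x :: 'a by simp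
  then show ?case by blast
next
  case (add f g)
  then obtain C m D n where *: "\<And>x. \<bar>f x\<bar> \<le> C * (1 + norm x) ^ m" "\<And>x. \<bar>g x\<bar> \<le> D * (1 + norm x) ^ n"
    by blast
  have "C \<ge> 0" "D \<ge> 0" using *[of 0] by auto
  have "\<bar>f x + g x\<bar> \<le> (C + D) * (1 + norm x) ^ (m + n)" for x
  proof -
    have "C * (1 + norm x) ^ m \<le> C * (1 + norm x) ^ (m + n)" "D * (1 + norm x) ^ n \<le> D * (1 + norm x) ^ (m + n)"
      using \<open>C \<ge> 0\<close> \<open>D \<ge> 0\<close> by (auto intro!: mult_left_mono power_increasing)
    then show ?thesis using *[of x] by (simp add: distrib_right)
  qed
  then show ?case by blast
next
  case (mult f g)
  then obtain C m D n where *: "\<And>x. \<bar>f x\<bar> \<le> C * (1 + norm x) ^ m" "\<And>x. \<bar>g x\<bar> \<le> D * (1 + norm x) ^ n"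
    by blast
  have "\<bar>f x * g x\<bar> \<le> (C * D) * (1 + norm x) ^ (m + n)" for x
    using mult_mono'[OF *(1)[of x] *(2)[of x]] by (simp add: abs_mult power_add mult_ac)
  then show ?case by blast
qed

lemma gaussian_translate_has_derivative:
  "((\<lambda>t. gaussian (a - t)) has_derivative (\<lambda>v. complex_of_real (2 * pi * ((a - t) \<bullet> v)) * gaussian (a - t))) (at t)"
  unfolding gaussian_def power2_norm_eq_inner of_real_mult[symmetric]
  by (rule has_derivative_of_real)
    (auto intro!: derivative_eq_intros simp: inner_commute algebra_simps)

text \<open>Polynomials times a fixed translated Gaussian are closed under directional derivatives:
  direction \<open>b\<close> turns the factor \<open>q\<close> into
  \<open>2 * pi * ((a - t) \<bullet> b)\<close> times \<open>q\<close>, plus the derivative of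
  \<open>q\<close> along \<open>b\<close>.\<close>

lemma iter_deriv_polynomial_gaussian:
  fixes a :: "'a::euclidean_space"
  assumes "real_polynomial_function p"
  shows "\<exists>q. real_polynomial_function q \<and>
     iter_deriv bs (\<lambda>t. complex_of_real (p t) * gaussian (a - t)) = (\<lambda>t. complex_of_real (q t) * gaussian (a - t))"
proof (induction bs)
  case Nil
  then show ?case using assms by (auto simp: iter_deriv_def)
next
  case (Cons b bs)
  then obtain q where q: "real_polynomial_function q"
    and it: "iter_deriv bs (\<lambda>t. complex_of_real (p t) * gaussian (a - t)) =
        (\<lambda>t. complex_of_real (q t) * gaussian (a - t))" by blast
  obtain q' where q': "\<And>x. (q has_derivative q' x) (at x)" "\<And>v. real_polynomial_function (\<lambda>x. q' x v)"
    using real_polynomial_function_has_derivative[OF q] by blast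
  have d: "((\<lambda>t. complex_of_real (q t) * gaussian (a - t)) has_derivative
      (\<lambda>v. complex_of_real (q t * (2 * pi * ((a - t) \<bullet> v)) + q' t v) * gaussian (a - t))) (at t)" for t
    by (rule has_derivative_eq_rhs[OF has_derivative_mult[OF has_derivative_of_real[OF q'(1)]
          gaussian_translate_has_derivative]]) (simp add: algebra_simps)
  have "iter_deriv (b # bs) (\<lambda>t. complex_of_real (p t) * gaussian (a - t)) =
      (\<lambda>t. complex_of_real (q t * (2 * pi * ((a - t) \<bullet> b)) + q' t b) * gaussian (a - t))"
    using it frechet_derivative_at[OF d, symmetric] by (simp add: iter_deriv_def)
  moreover have "real_polynomial_function (\<lambda>t. q t * (2 * pi * ((a - t) \<bullet> b)) + q' t b)"
    using q q'(2) unfolding inner_diff_left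
    by (intro real_polynomial_function.intros(2-4) real_polynomial_function_diff
          real_polynomial_function.intros(1)[OF bounded_linear_inner_left]) auto
  ultimately show ?case by blast
qed

text \<open>With \<open>r = norm (a - t)\<close>, all powers of \<open>1 + norm t\<close> are traded
  for powers of \<open>1 + r\<close> at the price of powers of \<open>1 + norm a\<close>. Then
  \<open>(1 + r) ^ M \<le> exp (M * r)\<close>, which the Gaussian dominates.\<close>

lemma polynomial_gaussian_bounded:
  fixes a :: "'a::euclidean_space"
  assumes "real_polynomial_function q"
  shows "bounded (range (\<lambda>t. (1 + norm t) ^ N * norm (complex_of_real (q t) * gaussian (a - t))))"
proof -
  obtain C m where C: "\<And>x. \<bar>q x\<bar> \<le> C * (1 + norm x) ^ m"
    using real_polynomial_function_growth[OF assms] by blast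
  have "C \<ge> 0" using C[of 0] by auto
  define M where "M = N + m"
  have "\<bar>(1 + norm t) ^ N * norm (complex_of_real (q t) * gaussian (a - t))\<bar> \<le>
      C * (1 + norm a) ^ M * exp ((real M)\<^sup>2 / 4)" for t
  proof -
    define r where "r = norm (a - t)"
    have "norm t \<le> norm a + r" unfolding r_def by norm
    then have t: "1 + norm t \<le> (1 + norm a) * (1 + r)"
      
    proof -
      have "0 \<le> norm a * r" by (simp add: r_def)
      with \<open>norm t \<le> norm a + r\<close> show ?thesis by (simp add: distrib_left distrib_right)
    qed
    have "(1 + r) ^ M \<le> exp r ^ M"
      by (intro power_mono) (auto simp: r_def intro: exp_ge_add_one_self)
    also have "\<dots> = exp (M * r)" by (simp add: exp_of_nat_mult)
    finally have "(1 + r) ^ M * exp (- pi * r\<^sup>2) \<le> exp (M * r) * exp (- pi * r\<^sup>2)"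
      by (intro mult_right_mono) auto
    also have "\<dots> \<le> exp ((real M)\<^sup>2 / 4) * exp (- 2 * r\<^sup>2)"
      by (rule exp_linear_gaussian_bound) (simp add: r_def)
    also have "\<dots> \<le> exp ((real M)\<^sup>2 / 4) * 1"
      by (intro mult_left_mono) auto
    finally have g: "(1 + r) ^ M * exp (- pi * r\<^sup>2) \<le> exp ((real M)\<^sup>2 / 4)" by simp
    have "(1 + norm t) ^ N * norm (complex_of_real (q t) * gaussian (a - t)) =
        (1 + norm t) ^ N * \<bar>q t\<bar> * exp (- pi * r\<^sup>2)"
      by (simp add: norm_mult norm_gaussian r_def)
    also have "\<dots> \<le> (1 + norm t) ^ N * (C * (1 + norm t) ^ m) * exp (- pi * r\<^sup>2)"
      by (intro mult_right_mono mult_left_mono C) auto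
    also have "\<dots> = C * exp (- pi * r\<^sup>2) * (1 + norm t) ^ M"
      by (simp add: M_def power_add)
    also have "\<dots> \<le> C * exp (- pi * r\<^sup>2) * ((1 + norm a) * (1 + r)) ^ M"
      using \<open>C \<ge> 0\<close> t by (intro mult_left_mono power_mono) auto
    also have "\<dots> = C * (1 + norm a) ^ M * ((1 + r) ^ M * exp (- pi * r\<^sup>2))"
      by (simp add: power_mult_distrib)
    also have "\<dots> \<le> C * (1 + norm a) ^ M * exp ((real M)\<^sup>2 / 4)"
      using \<open>C \<ge> 0\<close> g by (intro mult_left_mono) auto
    finally show ?thesis by simp
  qed
  then show ?thesis by (auto simp: bounded_iff)
qed

lemma gaussian_translate_schwartz: "(\<lambda>t. gaussian (a - t)) \<in> schwartz"
proof -
  have "(\<forall>t. iter_deriv bs (\<lambda>t. gaussian (a - t)) differentiable at t) \<and>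
     (\<forall>N. bounded (range (\<lambda>t. (1 + norm t) ^ N * norm (iter_deriv bs (\<lambda>t. gaussian (a - t)) t))))" for bs
  proof -
    obtain q where q: "real_polynomial_function q"
      and it: "iter_deriv bs (\<lambda>t. gaussian (a - t)) = (\<lambda>t. complex_of_real (q t) * gaussian (a - t))"
      using iter_deriv_polynomial_gaussian[OF real_polynomial_function.intros(2), of bs 1 a] by auto
    obtain q' where "\<And>x. (q has_derivative q' x) (at x)"
      using real_polynomial_function_has_derivative[OF q] by blast
    then have "(\<lambda>t. complex_of_real (q t) * gaussian (a - t)) differentiable at t" for t
      by (intro differentiable_mult differentiableI[OF has_derivative_of_real]
            differentiableI[OF gaussian_translate_has_derivative])
    then show ?thesis using polynomial_gaussian_bounded[OF q] by (simp add: it)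
  qed
  then show ?thesis by (simp add: schwartz_def)
qed

section \<open>Differentiation under the integral sign\<close>

lemma norm_exp_minus_linear:
  "norm (exp b - 1 - b) \<le> (norm b)\<^sup>2 * exp (norm (b::complex))"
proof -
  have "norm (exp b - (\<Sum>i\<le>1. b ^ i / fact i)) \<le> exp \<bar>Re b\<bar> * norm b ^ Suc 1 / fact 1"
    by (rule Taylor_exp)
  also have "\<dots> \<le> exp (norm b) * (norm b)\<^sup>2"
    by (auto simp: power2_eq_square abs_Re_le_cmod intro!: mult_right_mono)
  finally show ?thesis by (simp add: mult.commute diff_diff_eq)
qed

text \<open>For \<open>norm w \<le> 1\<close> the first-order remainder of the exponential is
  quadratic in \<open>w\<close>, with a constant that is integrable against \<open>g\<close>; hence
  the remainder of the integral is quadratic too.\<close>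

lemma has_derivative_integral_exp:
  fixes g :: "'a::euclidean_space \<Rightarrow> complex" and \<kappa> :: real and l :: "'z::real_normed_vector \<Rightarrow> 'a \<Rightarrow> complex"
  assumes g [measurable]: "g \<in> borel_measurable borel"
    and gi: "\<And>k. integrable lborel (\<lambda>t. norm (g t) * exp (k * norm t))"
    and l: "\<And>t. linear (\<lambda>z. l z t)" and lb: "\<And>z t. norm (l z t) \<le> \<kappa> * norm z * norm t"
    and \<kappa>: "\<kappa> \<ge> 0"
    and lm [measurable]: "\<And>z. l z \<in> borel_measurable borel"
  shows "((\<lambda>z. LINT t|lborel. g t * exp (l z t)) has_derivative
           (\<lambda>w. LINT t|lborel. g t * l w t * exp (l z t))) (at z)"
proof -
  define L where "L = (\<lambda>w. LINT t|lborel. g t * l w t * exp (l z t))"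
  \<comment> \<open>The three summands pay for \<open>exp (l z t)\<close>, for the exponential in
    the Taylor remainder when \<open>norm w \<le> 1\<close>, and for the factor
    \<open>(norm t)\<^sup>2 \<le> exp (2 * norm t)\<close>.\<close>
  define k where "k = \<kappa> * norm z + \<kappa> + 2"
  define I where "I = (LINT t|lborel. norm (g t) * exp (k * norm t))"
  have le_exp: "s \<le> exp s" if "s \<ge> 0" for s :: real
    using exp_ge_add_one_self[of s] by linarith
  have nexp: "norm (exp (l w t)) \<le> exp (\<kappa> * norm w * norm t)" for w t
    using lb[of w t] complex_Re_le_cmod[of "l w t"] by simp
  have i0: "integrable lborel (\<lambda>t. g t * exp (l w t))" for w
  proof (rule Bochner_Integration.integrable_bound[OF gi[of "\<kappa> * norm w"]])
    show "AE t in lborel. norm (g t * exp (l w t)) \<le> norm (norm (g t) * exp (\<kappa> * norm w * norm t))"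
      by (intro AE_I2) (use nexp in \<open>auto simp: norm_mult intro!: mult_left_mono\<close>)
  qed simp
  have b1: "norm (g t * l w t * exp (l z t)) \<le> \<kappa> * norm w * (norm (g t) * exp (k * norm t))" for w t
  proof -
    have "norm t * exp (\<kappa> * norm z * norm t) \<le> exp (norm t) * exp (\<kappa> * norm z * norm t)"
      by (intro mult_right_mono le_exp) auto
    also have "\<dots> \<le> exp (k * norm t)"
      using \<kappa> by (simp add: k_def algebra_simps flip: exp_add)
    finally have e: "norm t * exp (\<kappa> * norm z * norm t) \<le> exp (k * norm t)" .
    have "norm (g t * l w t * exp (l z t)) \<le> norm (g t) * (\<kappa> * norm w * norm t) * exp (\<kappa> * norm z * norm t)"
      unfolding norm_mult by (intro mult_mono nexp lb order_refl) (use \<kappa> in auto)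
    also have "\<dots> = \<kappa> * norm w * norm (g t) * (norm t * exp (\<kappa> * norm z * norm t))"
      by simp
    also have "\<dots> \<le> \<kappa> * norm w * norm (g t) * exp (k * norm t)"
      using e \<kappa> by (intro mult_left_mono) auto
    finally show ?thesis by (simp add: mult.assoc)
  qed
  have i1: "integrable lborel (\<lambda>t. g t * l w t * exp (l z t))" for w
  proof (rule Bochner_Integration.integrable_bound)
    show "integrable lborel (\<lambda>t. \<kappa> * norm w * (norm (g t) * exp (k * norm t)))"
      using gi by auto
    show "AE t in lborel. norm (g t * l w t * exp (l z t)) \<le> norm (\<kappa> * norm w * (norm (g t) * exp (k * norm t)))"
      by (intro AE_I2) (use b1 \<kappa> in auto)
  qed simp
  have "bounded_linear L"
  proof
    show "L (v + w) = L v + L w" for v w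
      unfolding L_def
      by (subst Bochner_Integration.integral_add[OF i1 i1, symmetric])
        (simp add: linear_add[OF l] algebra_simps)
    show "L (r *\<^sub>R w) = r *\<^sub>R L w" for r w
      by (simp add: L_def linear_cmul[OF l])
    have "norm (L w) \<le> norm w * (\<kappa> * I)" for w
    proof -
      have "norm (L w) \<le> (LINT t|lborel. \<kappa> * norm w * (norm (g t) * exp (k * norm t)))"
        unfolding L_def
        by (rule Bochner_Integration.integral_norm_bound_integral[OF i1]) (use gi b1 in auto)
      then show ?thesis by (simp add: I_def mult_ac)
    qed
    then show "\<exists>K. \<forall>w. norm (L w) \<le> norm w * K" by blast
  qed
  have rem: "norm ((LINT t|lborel. g t * exp (l (z + w) t)) - (LINT t|lborel. g t * exp (l z t)) - L w)
      \<le> \<kappa>\<^sup>2 * I * (norm w)\<^sup>2" if "norm w \<le> 1" for w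
  proof -
    have b2: "norm (g t * exp (l (z + w) t) - g t * exp (l z t) - g t * l w t * exp (l z t))
        \<le> \<kappa>\<^sup>2 * (norm w)\<^sup>2 * (norm (g t) * exp (k * norm t))" for t
    proof -
      have "(norm t)\<^sup>2 * exp (\<kappa> * norm t) * exp (\<kappa> * norm z * norm t)
          \<le> (exp (norm t))\<^sup>2 * exp (\<kappa> * norm t) * exp (\<kappa> * norm z * norm t)"
        by (intro mult_right_mono power_mono le_exp) auto
      also have "\<dots> = exp (k * norm t)"
        by (simp add: k_def algebra_simps flip: exp_add exp_double)
      finally have e: "(norm t)\<^sup>2 * exp (\<kappa> * norm t) * exp (\<kappa> * norm z * norm t) \<le> exp (k * norm t)" .
      have "g t * exp (l (z + w) t) - g t * exp (l z t) - g t * l w t * exp (l z t)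
          = g t * (exp (l w t) - 1 - l w t) * exp (l z t)"
        by (simp add: linear_add[OF l] exp_add algebra_simps)
      also have "norm \<dots> \<le> norm (g t) * ((\<kappa> * norm w * norm t)\<^sup>2 * exp (\<kappa> * norm t)) * exp (\<kappa> * norm z * norm t)"
      proof -
        have "norm (l w t) \<le> \<kappa> * norm t"
        proof (rule order_trans[OF lb])
          have "\<kappa> * norm w * norm t \<le> \<kappa> * 1 * norm t"
            using that \<kappa> by (intro mult_right_mono mult_left_mono) auto
          then show "\<kappa> * norm w * norm t \<le> \<kappa> * norm t" by simp
        qed
        then have "norm (exp (l w t) - 1 - l w t) \<le> (\<kappa> * norm w * norm t)\<^sup>2 * exp (\<kappa> * norm t)"
          using lb \<kappa> by (intro order_trans[OF norm_exp_minus_linear] mult_mono power_mono) auto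
        then show ?thesis
          unfolding norm_mult by (intro mult_mono nexp order_refl) auto
      qed
      also have "\<dots> = \<kappa>\<^sup>2 * (norm w)\<^sup>2 * norm (g t) * ((norm t)\<^sup>2 * exp (\<kappa> * norm t) * exp (\<kappa> * norm z * norm t))"
        by (simp add: power_mult_distrib)
      also have "\<dots> \<le> \<kappa>\<^sup>2 * (norm w)\<^sup>2 * norm (g t) * exp (k * norm t)"
        using e by (intro mult_left_mono) auto
      finally show ?thesis by (simp add: mult.assoc)
    qed
    have "(LINT t|lborel. g t * exp (l (z + w) t)) - (LINT t|lborel. g t * exp (l z t)) - L w =
       (LINT t|lborel. g t * exp (l (z + w) t) - g t * exp (l z t) - g t * l w t * exp (l z t))"
      unfolding L_def using i0 i1 by simp
    also have "norm \<dots> \<le> (LINT t|lborel. \<kappa>\<^sup>2 * (norm w)\<^sup>2 * (norm (g t) * exp (k * norm t)))"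
      by (rule Bochner_Integration.integral_norm_bound_integral) (use gi i0 i1 b2 in auto)
    also have "\<dots> = \<kappa>\<^sup>2 * I * (norm w)\<^sup>2"
      by (simp add: I_def)
    finally show ?thesis .
  qed
  have "((\<lambda>w. norm ((LINT t|lborel. g t * exp (l (z + w) t)) - (LINT t|lborel. g t * exp (l z t)) - L w) / norm w)
      \<longlongrightarrow> 0) (at 0)"
  proof (rule tendsto_sandwich[where f = "\<lambda>_. 0"])
    show "((\<lambda>w::'z. \<kappa>\<^sup>2 * I * norm w) \<longlongrightarrow> 0) (at 0)"
      by (auto intro!: tendsto_eq_intros)
    have "\<forall>\<^sub>F w in at 0. norm (w::'z) < 1"
      by (auto simp: eventually_at intro: exI[of _ 1])
    then show "\<forall>\<^sub>F w in at 0. norm ((LINT t|lborel. g t * exp (l (z + w) t)) - (LINT t|lborel. g t * exp (l z t)) - L w) / norm w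
        \<le> \<kappa>\<^sup>2 * I * norm w"
    proof eventually_elim
      case (elim w)
      then show ?case
        using rem[of w] by (cases "w = 0") (auto simp: divide_le_eq power2_eq_square mult.assoc)
    qed
  qed auto
  then show ?thesis
    using \<open>bounded_linear L\<close> by (simp add: has_derivative_at L_def)
qed


section \<open>Symplectic linear algebra\<close>

text \<open>The standard complex structure \<open>J\<close>: multiplication by \<open>\<i>\<close>
  when \<open>(x, \<xi>)\<close> is read as \<open>x + \<i> \<xi>\<close>. Thus
  \<open>v \<bullet> rot90 w\<close> is, up to sign convention, the symplectic form.\<close>

definition rot90 :: "'a::real_inner \<times> 'a \<Rightarrow> 'a \<times> 'a" where
  "rot90 = (\<lambda>(x, \<xi>). (- \<xi>, x))"

lemma rot90_rot90 [simp]: "rot90 (rot90 w) = - w"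
  by (cases w) (simp add: rot90_def)

lemma linear_block_apply: "linear (block_apply A B C D)"
  by (auto intro!: linearI simp: block_apply_def algebra_simps matrix_vector_mult_scaleR
        matrix_vector_right_distrib)

lemma inner_matrix_mult: "(A *v x) \<bullet> (B *v y) = x \<bullet> ((transpose A ** B) *v y)" for A B :: "real^'n^'n"
  by (metis dot_lmul_matrix inner_commute matrix_vector_mul_assoc transpose_matrix_vector)

lemma symplectic_transpose:
  fixes A B C D :: "real^'n^'n"
  assumes "symplectic A B C D"
  shows "transpose D ** A - transpose B ** C = mat 1"
proof -
  have "transpose (transpose A ** D - transpose C ** B) = (mat 1 :: real^'n^'n)"
    using assms by (simp add: symplectic_def transpose_mat)
  moreover have "transpose (X - Y) = transpose X - transpose Y" for X Y :: "real^'n^'n"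
    by (simp add: transpose_def vec_eq_iff)
  ultimately show ?thesis by (simp add: matrix_transpose_mul)
qed

text \<open>Expanding the form produces exactly the block products that the symplectic relations,
  and the transpose of the third one, cancel.\<close>

lemma block_apply_inner_rot90:
  assumes "symplectic A B C D"
  shows "block_apply A B C D v \<bullet> rot90 (block_apply A B C D w) = v \<bullet> rot90 w"
proof -
  obtain x \<xi> x' \<xi>' where v: "v = (x, \<xi>)" and w: "w = (x', \<xi>')" by fastforce
  have 1: "transpose A ** C = transpose C ** A" "transpose B ** D = transpose D ** B"
    using assms by (auto simp: symplectic_def)
  have 2: "transpose A ** D = mat 1 + transpose C ** B"
    using assms by (simp add: symplectic_def algebra_simps)
  have 3: "transpose D ** A = mat 1 + transpose B ** C"
    using symplectic_transpose[OF assms] by (simp add: algebra_simps)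
  show ?thesis
    by (simp add: v w block_apply_def rot90_def inner_add_left inner_add_right inner_matrix_mult
        inner_diff_right 1 2 3 matrix_vector_mult_add_rdistrib)
qed

text \<open>A map preserving a nondegenerate form is injective: a kernel vector \<open>v\<close>
  pairs to zero with everything, in particular with \<open>rot90 v\<close>, which forces
  \<open>v = 0\<close>. In finite dimension injectivity gives surjectivity.\<close>

lemma surj_block_apply:
  assumes "symplectic A B C D"
  shows "surj (block_apply A B C D)"
proof (rule linear_inj_imp_surj[OF linear_block_apply])
  have "v = 0" if "block_apply A B C D v = 0" for v
  proof -
    have "v \<bullet> rot90 (rot90 v) = 0"
      using block_apply_inner_rot90[OF assms, of v "rot90 v"] that by simp
    then show ?thesis by simp
  qed
  then show "inj (block_apply A B C D)"
    by (simp add: linear_injective_0[OF linear_block_apply])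
qed

text \<open>The inverse of a symplectic matrix has first block row
  \<open>D\<^sup>T, - B\<^sup>T\<close> and second block row \<open>- C\<^sup>T, A\<^sup>T\<close>,
  so it sends \<open>(x, 0)\<close> to \<open>(D\<^sup>T x, - C\<^sup>T x)\<close>. The second entry
  vanishes exactly on the orthogonal complement of the range of \<open>C\<close>.\<close>

lemma block_apply_zero_set:
  assumes "symplectic A B C D"
  shows "(x, 0) = block_apply A B C D (y, 0) \<longleftrightarrow>
    x \<in> orthogonal_comp (range ((*v) C)) \<and> y = transpose D *v x"
proof -
  have s: "transpose A ** C - transpose C ** A = 0" "transpose D ** B - transpose B ** D = 0"
    "transpose A ** D - transpose C ** B = mat 1" "transpose D ** A - transpose B ** C = mat 1"
    using assms symplectic_transpose[OF assms] by (auto simp: symplectic_def)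
  have orth: "x \<in> orthogonal_comp (range ((*v) C)) \<longleftrightarrow> transpose C *v x = 0" for x
  proof -
    have "orthogonal (C *v y) x \<longleftrightarrow> (transpose C *v x) \<bullet> y = 0" for y
      by (metis orthogonal_def dot_lmul_matrix inner_commute transpose_matrix_vector)
    then have "x \<in> orthogonal_comp (range ((*v) C)) \<longleftrightarrow> (\<forall>y. (transpose C *v x) \<bullet> y = 0)"
      by (simp add: orthogonal_comp_def)
    then show ?thesis by (metis inner_eq_zero_iff inner_zero_left)
  qed
  have inverse: "transpose D *v (A *v p + B *v q) - transpose B *v (C *v p + D *v q) = p"
    "transpose A *v (C *v p + D *v q) - transpose C *v (A *v p + B *v q) = q" for p q
  proof -
    have "transpose D *v (A *v p + B *v q) - transpose B *v (C *v p + D *v q) =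
        (transpose D ** A - transpose B ** C) *v p + (transpose D ** B - transpose B ** D) *v q"
      by (simp add: matrix_vector_right_distrib matrix_vector_mul_assoc matrix_vector_mult_diff_rdistrib)
    then show "transpose D *v (A *v p + B *v q) - transpose B *v (C *v p + D *v q) = p"
      by (simp only: s matrix_vector_mul_lid matrix_vector_mult_0 add_0 add_0_right)
    have "transpose A *v (C *v p + D *v q) - transpose C *v (A *v p + B *v q) =
        (transpose A ** C - transpose C ** A) *v p + (transpose A ** D - transpose C ** B) *v q"
      by (simp add: matrix_vector_right_distrib matrix_vector_mul_assoc matrix_vector_mult_diff_rdistrib)
    then show "transpose A *v (C *v p + D *v q) - transpose C *v (A *v p + B *v q) = q"
      by (simp only: s matrix_vector_mul_lid matrix_vector_mult_0 add_0 add_0_right)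
  qed
  show ?thesis
  proof
    assume "(x, 0) = block_apply A B C D (y, 0)"
    then have "A *v y = x" "C *v y = 0" by (auto simp: block_apply_def)
    then show "x \<in> orthogonal_comp (range ((*v) C)) \<and> y = transpose D *v x"
      using inverse[of y 0] orth by simp
  next
    assume x: "x \<in> orthogonal_comp (range ((*v) C)) \<and> y = transpose D *v x"
    \<comment> \<open>The identities \<open>inverse\<close> express a left inverse only;
      surjectivity supplies a preimage whose entries they identify.\<close>
    obtain p q where pq: "block_apply A B C D (p, q) = (x, 0)"
      using surj_block_apply[OF assms] by (metis surj_def surj_pair)
    then have "A *v p + B *v q = x" "C *v p + D *v q = 0" by (auto simp: block_apply_def)
    then have "p = y" "q = 0" using inverse[of p q] x orth by auto
    then show "(x, 0) = block_apply A B C D (y, 0)" using pq by simp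
  qed
qed

section \<open>Positive definiteness and integration along rays\<close>

text \<open>\<open>R\<close> is the inverse of \<open>1 + S S\<^sup>T\<close>, which exists because
  the quadratic form of that operator at \<open>w\<close> is at least
  \<open>(norm w)\<^sup>2\<close>. Substituting \<open>w = R z\<close> shows that the form of
  \<open>R\<close> is positive definite as well.\<close>

lemma inverse_id_plus_S_adjoint:
  fixes S :: "'a::euclidean_space \<Rightarrow> 'a"
  assumes S: "linear S"
  obtains R where "linear R" "\<And>z. R z + S (adjoint S (R z)) = z"
    "\<And>z. z \<bullet> R z \<ge> 0" "\<And>z. z \<bullet> R z = 0 \<longleftrightarrow> z = 0"
proof -
  define T where "T = (\<lambda>w. w + S (adjoint S w))"
  have T: "linear T"
    unfolding T_def
    using linear_compose[OF adjoint_linear[OF S] S] by (intro linear_compose_add linear_ident) (auto simp: o_def)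
  have TT: "T w \<bullet> w = (norm w)\<^sup>2 + (norm (adjoint S w))\<^sup>2" for w
    by (simp add: T_def inner_add_left power2_norm_eq_inner adjoint_works[OF S])
  have "w = 0" if "T w = 0" for w
    using TT[of w] that by (simp add: add_nonneg_eq_0_iff)
  then have inj: "inj T" by (simp add: linear_injective_0[OF T])
  then have surj: "surj T" by (rule linear_inj_imp_surj[OF T])
  have R: "T (inv T z) = z" for z by (rule surj_f_inv_f[OF surj])
  have zR: "z \<bullet> inv T z = (norm (inv T z))\<^sup>2 + (norm (adjoint S (inv T z)))\<^sup>2" for z
    using TT[of "inv T z"] by (simp add: R)
  show ?thesis
  proof
    show "linear (inv T)" by (rule inj_linear_imp_inv_linear[OF T inj])
    show "inv T z + S (adjoint S (inv T z)) = z" for z using R[of z] by (simp add: T_def)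
    show "z \<bullet> inv T z \<ge> 0" for z by (simp add: zR)
    show "z \<bullet> inv T z = 0 \<longleftrightarrow> z = 0" for z
    proof
      assume "z \<bullet> inv T z = 0"
      then have "inv T z = 0" by (simp add: zR add_nonneg_eq_0_iff)
      then show "z = 0" using R[of z] linear_0[OF T] by simp
    qed simp
  qed
qed

text \<open>Along the ray through \<open>z\<close> the squared modulus of \<open>F\<close>,
  multiplied by the inverse of the expected decay, has derivative zero. The equation is never
  divided by \<open>F\<close>, so zeros of \<open>F\<close> need no separate treatment.\<close>

lemma norm_eq_gaussian_if_log_derivative:
  fixes F :: "'a::euclidean_space \<Rightarrow> complex"
  assumes deriv: "\<And>z. \<exists>F'. (F has_derivative F') (at z) \<and>
     (\<forall>w. \<exists>r. F' w = Complex (- 2 * pi * (z \<bullet> R w)) r * F z)"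
    and R: "linear R"
  shows "norm (F z) = norm (F 0) * exp (- pi * (z \<bullet> R z))"
proof -
  define q where "q = z \<bullet> R z"
  define g where "g = (\<lambda>s. (F (s *\<^sub>R z) \<bullet> F (s *\<^sub>R z)) * exp (2 * pi * q * s\<^sup>2))"
  have "(g has_field_derivative 0) (at s)" for s
  proof -
    obtain F' r where F': "(F has_derivative F') (at (s *\<^sub>R z))"
      and r: "F' z = Complex (- 2 * pi * ((s *\<^sub>R z) \<bullet> R z)) r * F (s *\<^sub>R z)"
      using deriv by meson
    have "((\<lambda>s. s *\<^sub>R z) has_derivative (\<lambda>h. h *\<^sub>R z)) (at s)"
      by (auto intro!: derivative_eq_intros)
    then have d: "((\<lambda>s. F (s *\<^sub>R z)) has_derivative (\<lambda>h. F' (h *\<^sub>R z))) (at s)"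
      by (rule has_derivative_compose) (rule F')
    have lin: "F' (h *\<^sub>R z) = h *\<^sub>R F' z" for h
      using has_derivative_linear[OF F'] by (rule linear_cmul)
    \<comment> \<open>The imaginary part \<open>r\<close> of the logarithmic derivative only turns
      the phase and drops out of the real inner product.\<close>
    have in1: "F (s *\<^sub>R z) \<bullet> F' z = - 2 * pi * s * q * (F (s *\<^sub>R z) \<bullet> F (s *\<^sub>R z))"
      unfolding r by (simp add: q_def inner_complex_def algebra_simps)
    show ?thesis
      unfolding g_def has_field_derivative_def
      by (rule has_derivative_eq_rhs, (rule derivative_intros d)+)
        (auto simp: fun_eq_iff lin in1 inner_commute[of "F' z"] algebra_simps)
  qed
  then have "g 1 = g 0"
    by (intro DERIV_isconst_all) auto
  then have "((norm (F z)) * exp (pi * q))\<^sup>2 = (norm (F 0))\<^sup>2"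
    by (simp add: g_def power_mult_distrib power2_norm_eq_inner mult.assoc flip: exp_double)
  then have "norm (F z) * exp (pi * q) = norm (F 0)"
    by (simp add: power2_eq_iff_nonneg)
  then show ?thesis by (simp add: q_def exp_minus field_simps)
qed


section \<open>Time-frequency shifts\<close>

lemma square_integrable_rep_l2: "square_integrable (rep_l2 h)"
  using Quotient3_rep_reflp[OF Quotient3_l2, of h] by (simp add: l2_rel_def)

lemma abs_rep_l2: "abs_l2 (rep_l2 h) = h"
  by (rule Quotient3_abs_rep[OF Quotient3_l2])

lemma l2_rel_refl: "square_integrable f \<Longrightarrow> l2_rel f f"
  by (simp add: l2_rel_def)

lemma l2_inner_abs_l2:
  assumes "square_integrable f" "square_integrable g"
  shows "l2_inner (abs_l2 f) (abs_l2 g) = (LINT t|lborel. f t * cnj (g t))"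
  using assms by (intro l2_inner.abs_eq l2_rel_refl)

lemma l2_inner_rep_l2:
  assumes "square_integrable g"
  shows "l2_inner h (abs_l2 g) = (LINT t|lborel. rep_l2 h t * cnj (g t))"
  using l2_inner_abs_l2[OF square_integrable_rep_l2 assms, of h] by (simp add: abs_rep_l2)

lemma l2_inner_commute: "l2_inner g h = cnj (l2_inner h g)"
proof -
  have "l2_inner (abs_l2 (rep_l2 g)) (abs_l2 (rep_l2 h)) = cnj (l2_inner (abs_l2 (rep_l2 h)) (abs_l2 (rep_l2 g)))"
    unfolding l2_inner_abs_l2[OF square_integrable_rep_l2 square_integrable_rep_l2] Bochner_Integration.integral_cnj[symmetric]
    by (simp only: complex_cnj_mult complex_cnj_cnj mult.commute)
  then show ?thesis by (simp add: abs_rep_l2)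
qed

text \<open>The shift \<open>rho z 0\<close> on representatives, where pointwise computation is
  possible.\<close>

definition rho_fun :: "(real^'n) \<times> (real^'n) \<Rightarrow> (real^'n \<Rightarrow> complex) \<Rightarrow> real^'n \<Rightarrow> complex" where
  "rho_fun z f t = exp (- \<i> * pi * (fst z \<bullet> snd z)) * exp (2 * pi * \<i> * (snd z \<bullet> t)) * f (t - fst z)"

lemma square_integrable_rho_fun:
  assumes "square_integrable f"
  shows "square_integrable (rho_fun z f)"
  unfolding rho_fun_def [abs_def]
  by (rule square_integrable_unimodular[OF square_integrable_shift[OF assms]]) (auto simp: norm_mult)

lemma rho_abs_l2:
  assumes "square_integrable f"
  shows "rho z 0 (abs_l2 f) = abs_l2 (rho_fun z f)"
  using assms
  by (simp add: rho.abs_eq l2_rel_refl rho_fun_def[abs_def] case_prod_beta)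

lemma rho_zero: "rho 0 0 h = h"
proof -
  have "rho 0 0 (abs_l2 (rep_l2 h)) = abs_l2 (rep_l2 h)"
    by (simp add: rho_abs_l2 square_integrable_rep_l2 rho_fun_def[abs_def])
  then show ?thesis by (simp add: abs_rep_l2)
qed

lemma integral_lborel_translate:
  fixes f :: "'a::euclidean_space \<Rightarrow> complex"
  assumes [measurable]: "f \<in> borel_measurable borel"
  shows "(LINT t|lborel. f (t + a)) = (LINT t|lborel. f t)"
proof -
  have "(LINT t|lborel. f t) = (LINT t|distr lborel borel ((+) a). f t)"
    by (simp add: lborel_distr_plus)
  also have "\<dots> = (LINT t|lborel. f (a + t))"
    by (rule integral_distr) auto
  finally show ?thesis by (simp add: add.commute)
qed

text \<open>This is the Heisenberg composition law in weak form: after the substitution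
  \<open>t + x'\<close> for \<open>t\<close> the integrands agree up to a constant phase, given by
  the symplectic form.\<close>

lemma l2_inner_rho_rho:
  fixes f g :: "(real^'n) l2"
  shows "l2_inner (rho (x', \<xi>') 0 f) (rho (x, \<xi>) 0 g) =
    exp (\<i> * pi * (x \<bullet> \<xi>' - x' \<bullet> \<xi>)) * l2_inner f (rho (x - x', \<xi> - \<xi>') 0 g)"
proof -
  define F G where "F = rep_l2 f" and "G = rep_l2 g"
  have sq: "square_integrable F" "square_integrable G"
    by (simp_all add: F_def G_def square_integrable_rep_l2)
  have fg: "f = abs_l2 F" "g = abs_l2 G" by (simp_all add: F_def G_def abs_rep_l2)
  have [measurable]: "rho_fun (x', \<xi>') F \<in> borel_measurable borel" "rho_fun (x, \<xi>) G \<in> borel_measurable borel"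
    using square_integrable_rho_fun[OF sq(1)] square_integrable_rho_fun[OF sq(2)]
    by (auto simp: square_integrable_def)
  have [measurable]: "(\<lambda>t. cnj (rho_fun (x, \<xi>) G t)) \<in> borel_measurable borel"
    by (rule measurable_compose[OF _ borel_measurable_continuous_onI[of cnj]]) (auto intro: continuous_intros)
  have eq: "rho_fun (x', \<xi>') F (t + x') * cnj (rho_fun (x, \<xi>) G (t + x')) =
      exp (\<i> * pi * (x \<bullet> \<xi>' - x' \<bullet> \<xi>)) * (F t * cnj (rho_fun (x - x', \<xi> - \<xi>') G t))" for t
  proof -
    have shift: "t + x' - x = t - (x - x')" by simp
    have "exp (- \<i> * pi * (x' \<bullet> \<xi>')) * exp (2 * pi * \<i> * (\<xi>' \<bullet> (t + x'))) *
        (exp (\<i> * pi * (x \<bullet> \<xi>)) * exp (- (2 * pi * \<i> * (\<xi> \<bullet> (t + x'))))) =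
      exp (\<i> * pi * (x \<bullet> \<xi>' - x' \<bullet> \<xi>)) *
        (exp (\<i> * pi * ((x - x') \<bullet> (\<xi> - \<xi>'))) * exp (- (2 * pi * \<i> * ((\<xi> - \<xi>') \<bullet> t))))"
      unfolding exp_add[symmetric]
      by (rule arg_cong[of _ _ exp])
        (simp add: inner_add_left inner_add_right inner_diff_left inner_diff_right inner_commute algebra_simps)
    then show ?thesis
      unfolding rho_fun_def fst_conv snd_conv shift
      by (simp add: exp_cnj algebra_simps)
  qed
  have "l2_inner (rho (x', \<xi>') 0 f) (rho (x, \<xi>) 0 g) =
      (LINT t|lborel. rho_fun (x', \<xi>') F t * cnj (rho_fun (x, \<xi>) G t))"
    by (simp add: fg rho_abs_l2 l2_inner_abs_l2 sq square_integrable_rho_fun)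
  also have "\<dots> = (LINT t|lborel. rho_fun (x', \<xi>') F (t + x') * cnj (rho_fun (x, \<xi>) G (t + x')))"
    by (rule integral_lborel_translate[symmetric]) measurable
  also have "\<dots> = exp (\<i> * pi * (x \<bullet> \<xi>' - x' \<bullet> \<xi>)) * l2_inner f (rho (x - x', \<xi> - \<xi>') 0 g)"
    unfolding eq by (simp add: fg rho_abs_l2 l2_inner_abs_l2 sq square_integrable_rho_fun)
  finally show ?thesis .
qed

corollary norm_l2_inner_rho_rho:
  "norm (l2_inner (rho w 0 f) (rho z 0 g)) = norm (l2_inner f (rho (z - w) 0 g))"
  by (cases w; cases z) (simp add: l2_inner_rho_rho norm_mult flip: of_real_mult of_real_diff)

corollary l2_inner_rho_left: "l2_inner (rho w 0 f) g = l2_inner f (rho (- w) 0 g)"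
  using l2_inner_rho_rho[of "fst w" "snd w" f 0 0 g] by (simp add: rho_zero flip: zero_prod_def uminus_prod_def)


section \<open>The Gabor transform with Gaussian window\<close>

text \<open>The short-time Fourier transform with Gaussian window, in the phase normalisation of
  \<open>rho\<close>. For \<open>h = U (abs_l2 gaussian)\<close> it is the function \<open>F\<close>
  of the overview.\<close>

definition gabor :: "(real^'n) l2 \<Rightarrow> (real^'n) \<times> (real^'n) \<Rightarrow> complex" where
  "gabor h z = l2_inner h (rho z 0 (abs_l2 gaussian))"

text \<open>With \<open>z = (x, \<xi>)\<close> this is
  \<open>2 \<pi> (x - \<i> \<xi>) \<bullet> t\<close>, the exponent of the Bargmann kernel in the
  conjugate variable.\<close>

definition bargmann_exponent :: "(real^'n) \<times> (real^'n) \<Rightarrow> real^'n \<Rightarrow> complex" where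
  "bargmann_exponent z t = Complex (2 * pi * (fst z \<bullet> t)) (- (2 * pi * (snd z \<bullet> t)))"

text \<open>Expanding the square in the shifted Gaussian separates a factor depending on
  \<open>z\<close> alone from an integral whose exponent is linear in \<open>z\<close>.\<close>

lemma gabor_eq:
  "gabor h z = exp (Complex (- pi * (fst z \<bullet> fst z)) (pi * (fst z \<bullet> snd z))) *
     (LINT t|lborel. rep_l2 h t * gaussian t * exp (bargmann_exponent z t))"
proof -
  have eq: "rep_l2 h t * cnj (rho_fun z gaussian t) =
      exp (Complex (- pi * (fst z \<bullet> fst z)) (pi * (fst z \<bullet> snd z))) *
        (rep_l2 h t * gaussian t * exp (bargmann_exponent z t))" for t
  proof -
    have "cnj (rho_fun z gaussian t) =
       exp (\<i> * pi * (fst z \<bullet> snd z)) * exp (- (2 * pi * \<i> * (snd z \<bullet> t))) * 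
         exp (complex_of_real (- pi * (norm (t - fst z))\<^sup>2))"
      by (simp add: rho_fun_def gaussian_def exp_cnj flip: exp_of_real)
    also have "\<dots> = exp (Complex (- pi * (fst z \<bullet> fst z)) (pi * (fst z \<bullet> snd z))) *
        exp (complex_of_real (- pi * (norm t)\<^sup>2)) * exp (bargmann_exponent z t)"
      unfolding exp_add[symmetric]
      by (rule arg_cong[of _ _ exp])
        (simp add: complex_eq_iff bargmann_exponent_def power2_norm_eq_inner inner_diff_left
          inner_diff_right inner_commute algebra_simps)
    finally show ?thesis by (simp add: gaussian_def flip: exp_of_real)
  qed
  show ?thesis
    unfolding gabor_def rho_abs_l2[OF square_integrable_gaussian]
      l2_inner_rep_l2[OF square_integrable_rho_fun[OF square_integrable_gaussian]] eq
    by simp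
qed

text \<open>Up to the Gaussian factor, \<open>gabor h\<close> is an antiholomorphic function of \<open>x + \<i> \<xi>\<close>.\<close>

lemma gabor_cauchy_riemann:
  fixes h :: "(real^'n) l2"
  shows "\<exists>F'. (gabor h has_derivative F') (at z) \<and>
    (\<forall>w. F' (rot90 w) + \<i> * F' w = - pi * Complex (z \<bullet> rot90 w) (z \<bullet> w) * gabor h z)"
proof -
  let ?g = "\<lambda>t. rep_l2 h t * gaussian t"
  define G where "G = (\<lambda>z. LINT t|lborel. ?g t * exp (bargmann_exponent z t))"
  define G' where "G' = (\<lambda>w. LINT t|lborel. ?g t * bargmann_exponent w t * exp (bargmann_exponent z t))"
  define E where "E = (\<lambda>z::(real^'n) \<times> (real^'n). exp (Complex (- pi * (fst z \<bullet> fst z)) (pi * (fst z \<bullet> snd z))))"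
  define e' where "e' = (\<lambda>w. Complex (- 2 * pi * (fst z \<bullet> fst w)) (pi * (fst z \<bullet> snd w + fst w \<bullet> snd z)))"
  have [measurable]: "rep_l2 h \<in> borel_measurable borel"
    using square_integrable_rep_l2[of h] by (simp add: square_integrable_def)
  have G': "(G has_derivative G') (at z)"
    unfolding G_def G'_def
  \<comment> \<open>Real and imaginary part each contribute
    \<open>2 * pi * norm z * norm t\<close>.\<close>
  proof (rule has_derivative_integral_exp[where \<kappa> = "4 * pi"])
    show "integrable lborel (\<lambda>t. norm (?g t) * exp (k * norm t))" for k
      by (rule integrable_square_integrable_gaussian[OF square_integrable_rep_l2])
    show "linear (\<lambda>z. bargmann_exponent z t)" for t :: "real^'n"
      by (auto intro!: linearI simp: bargmann_exponent_def complex_eq_iff inner_add_left algebra_simps)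
    show "norm (bargmann_exponent z t) \<le> 4 * pi * norm z * norm t" for z and t :: "real^'n"
    proof -
      have "\<bar>fst z \<bullet> t\<bar> \<le> norm z * norm t" "\<bar>snd z \<bullet> t\<bar> \<le> norm z * norm t"
        by (rule order_trans[OF Cauchy_Schwarz_ineq2 mult_right_mono];
            simp add: norm_fst_le[of "fst z" "snd z", simplified] norm_snd_le[of "snd z" "fst z", simplified])+
      then have "2 * pi * \<bar>fst z \<bullet> t\<bar> + 2 * pi * \<bar>snd z \<bullet> t\<bar> \<le> 2 * pi * (norm z * norm t) + 2 * pi * (norm z * norm t)"
        by (intro add_mono mult_left_mono) auto
      moreover have "norm (bargmann_exponent z t) \<le> 2 * pi * \<bar>fst z \<bullet> t\<bar> + 2 * pi * \<bar>snd z \<bullet> t\<bar>"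
        using cmod_le[of "bargmann_exponent z t"] by (simp add: bargmann_exponent_def abs_mult)
      ultimately show ?thesis by (simp add: algebra_simps)
    qed
    show "bargmann_exponent z \<in> borel_measurable borel" for z :: "(real^'n) \<times> (real^'n)"
      unfolding bargmann_exponent_def[abs_def] Complex_eq
      by (intro borel_measurable_continuous_onI continuous_intros)
  qed auto
  have "((\<lambda>z. Complex (- pi * (fst z \<bullet> fst z)) (pi * (fst z \<bullet> snd z))) has_derivative e') (at z)"
    unfolding Complex_eq e'_def
    by (auto intro!: derivative_eq_intros simp: inner_commute algebra_simps)
  then have E': "(E has_derivative (\<lambda>w. e' w * E z)) (at z)"
    unfolding E_def
    by (rule has_derivative_eq_rhs[OF has_derivative_compose[OF _
          has_field_derivative_imp_has_derivative[OF DERIV_exp]]]) (simp add: mult.commute)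
  have F: "gabor h = (\<lambda>z. E z * G z)" by (simp add: fun_eq_iff gabor_eq E_def G_def)
  \<comment> \<open>Antiholomorphy of the integral: \<open>rot90\<close> acts on the exponent as
    multiplication by \<open>- \<i>\<close>. So the integral satisfies the homogeneous equation, and
    the right-hand side comes from the prefactor \<open>E\<close> alone.\<close>
  have G'J: "G' (rot90 w) = - \<i> * G' w" for w
  proof -
    have "bargmann_exponent (rot90 w) t = - \<i> * bargmann_exponent w t" for t :: "real^'n"
      by (cases w) (simp add: bargmann_exponent_def rot90_def complex_eq_iff)
    then have "G' (rot90 w) = (LINT t|lborel. (- \<i>) * (?g t * bargmann_exponent w t * exp (bargmann_exponent z t)))"
      by (simp add: G'_def mult_ac)
    then show ?thesis by (simp only: integral_mult_right_zero G'_def)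
  qed
  show ?thesis
  proof (intro exI conjI allI)
    show "(gabor h has_derivative (\<lambda>w. E z * G' w + e' w * E z * G z)) (at z)"
      unfolding F by (rule has_derivative_mult[OF E' G'])
    fix w
    have "e' (rot90 w) + \<i> * e' w = - pi * Complex (z \<bullet> rot90 w) (z \<bullet> w)"
      by (cases z; cases w) (simp add: e'_def rot90_def complex_eq_iff algebra_simps inner_commute)
    then show "E z * G' (rot90 w) + e' (rot90 w) * E z * G z + \<i> * (E z * G' w + e' w * E z * G z) =
        - pi * Complex (z \<bullet> rot90 w) (z \<bullet> w) * gabor h z"
      unfolding F G'J by (simp only: algebra_simps flip: distrib_right) algebra
  qed
qed

text \<open>Restricted to \<open>(0, \<xi>)\<close>, the transform is the Fourier transform of
  \<open>h\<close> times the Gaussian. If it vanishes, so does that product almost everywhere, and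
  the Gaussian has no zeros.\<close>

lemma gabor_nonzero:
  fixes h :: "(real^'n) l2"
  assumes "l2_inner h h \<noteq> 0"
  shows "\<exists>z. gabor h z \<noteq> 0"
proof (rule ccontr)
  assume "\<nexists>z. gabor h z \<noteq> 0"
  then have "gabor h z = 0" for z by blast
  then have z: "(LINT t|lborel. rep_l2 h t * gaussian t * exp (bargmann_exponent z t)) = 0" for z
    unfolding gabor_eq by simp
  have "fourier_null (\<lambda>t. rep_l2 h t * gaussian t)"
    unfolding fourier_null_def
  proof (intro conjI allI)
    have "integrable lborel (\<lambda>t. norm (rep_l2 h t * gaussian t))"
      using integrable_square_integrable_gaussian[OF square_integrable_rep_l2, of h 0] by simp
    moreover have "rep_l2 h \<in> borel_measurable lborel"
      using square_integrable_rep_l2[of h] by (simp add: square_integrable_def)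
    ultimately show "integrable lborel (\<lambda>t. rep_l2 h t * gaussian t)"
      by (subst (asm) integrable_norm_iff) auto
    fix \<xi> :: "real^'n"
    \<comment> \<open>The scaling passes from the kernel
      \<open>exp (- 2 \<pi> \<i> \<xi> \<bullet> t)\<close> to the convention of
      \<open>fourier_null\<close>.\<close>
    have "bargmann_exponent (0, (- 1 / (2 * pi)) *\<^sub>R \<xi>) t = \<i> * complex_of_real (\<xi> \<bullet> t)" for t :: "real^'n"
      by (simp add: bargmann_exponent_def complex_eq_iff)
    then show "(LINT t|lborel. exp (\<i> * complex_of_real (\<xi> \<bullet> t)) * (rep_l2 h t * gaussian t)) = 0"
      using z[of "(0, (- 1 / (2 * pi)) *\<^sub>R \<xi>)"] by (simp add: mult.commute)
  qed
  then have "AE t in lborel. rep_l2 h t * gaussian t = 0"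
    by (rule fourier_null_AE_zero)
  then have "AE t in lborel. rep_l2 h t * cnj (rep_l2 h t) = 0"
    by eventually_elim (simp add: gaussian_def)
  then have "l2_inner (abs_l2 (rep_l2 h)) (abs_l2 (rep_l2 h)) = 0"
    by (simp add: l2_inner_abs_l2 square_integrable_rep_l2 integral_eq_zero_AE)
  then show False using assms by (simp add: abs_rep_l2)
qed

lemma l2_inner_gaussian_nonzero: "l2_inner (abs_l2 gaussian) (abs_l2 (gaussian :: real^'n \<Rightarrow> complex)) \<noteq> 0"
proof
  assume "l2_inner (abs_l2 gaussian) (abs_l2 (gaussian :: real^'n \<Rightarrow> complex)) = 0"
  then have "(LINT t|lborel. gaussian (t :: real^'n) * cnj (gaussian t)) = 0"
    by (simp add: l2_inner_abs_l2 square_integrable_gaussian)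
  moreover have "gaussian t * cnj (gaussian t) = complex_of_real ((norm (gaussian t))\<^sup>2)" for t :: "real^'n"
    by (rule complex_norm_square[symmetric])
  ultimately have "complex_of_real (LINT t|lborel. (norm (gaussian (t :: real^'n)))\<^sup>2) = 0"
    by (simp only: integral_complex_of_real)
  then have "(LINT t|lborel. (norm (gaussian (t :: real^'n)))\<^sup>2) = 0" by simp
  moreover have "integrable lborel (\<lambda>t :: real^'n. (norm (gaussian t))\<^sup>2)"
    using square_integrable_gaussian by (simp add: square_integrable_def)
  ultimately have "AE t in lborel. (norm (gaussian (t :: real^'n)))\<^sup>2 = 0"
    by (subst (asm) integral_nonneg_eq_0_iff_AE) auto
  then have "AE t::real^'n in lborel. False"
    by eventually_elim (simp add: gaussian_def)
  then show False
    by (simp add: eventually_False ae_filter_eq_bot_iff)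
qed


section \<open>Metaplectic operators\<close>

text \<open>The Gaussian on the product space is a tensor product, so the kernel is tested on a pair
  of translated Gaussians. They are even and real: the reflection in the convolution becomes a
  translation, and the bilinear pairing becomes the inner product.\<close>

lemma conv_dist_gaussian_kernel:
  fixes U :: "(real^'n) l2 \<Rightarrow> (real^'n) l2"
  assumes "schwartz_kernel (op_dist U) k"
  shows "conv_dist k gaussian (x, y) =
    l2_inner (U (rho (y, 0) 0 (abs_l2 gaussian))) (rho (x, 0) 0 (abs_l2 gaussian))"
proof -
  have 1: "gaussian ((x, y) - w) = (case w of (u, v) \<Rightarrow> gaussian (x - u) * gaussian (y - v))"
    for w :: "(real^'n) \<times> (real^'n)"
    by (cases w) (simp add: gaussian_def norm_Pair algebra_simps flip: of_real_mult exp_add)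
  have 2: "rho_fun (a, 0) gaussian = (\<lambda>v. gaussian (a - v))" for a :: "real^'n"
    by (simp add: fun_eq_iff rho_fun_def gaussian_def norm_minus_commute)
  have 3: "square_integrable (\<lambda>v. gaussian (a - v))" for a :: "real^'n"
    using square_integrable_rho_fun[OF square_integrable_gaussian, of "(a, 0)"] by (simp only: 2)
  have "conv_dist k gaussian (x, y) = op_dist U (\<lambda>v. gaussian (y - v)) (\<lambda>u. gaussian (x - u))"
    using assms[unfolded schwartz_kernel_def, THEN conjunct2, rule_format,
        OF gaussian_translate_schwartz gaussian_translate_schwartz]
    by (simp only: conv_dist_def 1)
  also have "\<dots> = l2_inner (U (rho (y, 0) 0 (abs_l2 gaussian))) (rho (x, 0) 0 (abs_l2 gaussian))"
    unfolding op_dist_def rho_abs_l2[OF square_integrable_gaussian] 2 l2_inner_rep_l2[OF 3]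
    by (simp add: gaussian_def)
  finally show ?thesis .
qed

text \<open>Only \<open>U (inv U f) = f\<close> is ever needed of \<open>inv U\<close>, so surjectivity of \<open>U\<close> suffices.\<close>

lemma metaplectic_rho:
  assumes "metaplectic S U"
  shows "U (rho w 0 (inv U f)) = rho (S w) 0 f"
  using assms by (metis comp_apply metaplectic_def)

text \<open>Moving the shift across \<open>U\<close> and then to the other argument conjugates the
  transform. This is the source of the second, conjugate Cauchy--Riemann system.\<close>

lemma metaplectic_gabor:
  assumes "metaplectic S U"
  shows "gabor (U (abs_l2 gaussian)) (S w) = cnj (gabor (inv U (abs_l2 gaussian)) (- w))"
proof -
  let ?\<phi> = "abs_l2 gaussian"
  have "gabor (U ?\<phi>) (S w) = l2_inner (U ?\<phi>) (U (rho w 0 (inv U ?\<phi>)))"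
    by (simp add: gabor_def metaplectic_rho[OF assms])
  also have "\<dots> = l2_inner ?\<phi> (rho w 0 (inv U ?\<phi>))"
    using assms by (simp add: metaplectic_def unitary_def)
  also have "\<dots> = cnj (gabor (inv U ?\<phi>) (- w))"
    unfolding gabor_def l2_inner_rho_left[symmetric] by (rule l2_inner_commute)
  finally show ?thesis .
qed

lemma metaplectic_norm_conv_dist:
  assumes U: "metaplectic S U" and S: "linear S" "surj S"
    and k: "schwartz_kernel (op_dist U) k"
  shows "norm (conv_dist k gaussian (x, y)) = norm (gabor (U (abs_l2 gaussian)) ((x, 0) - S (y, 0)))"
proof -
  let ?\<phi> = "abs_l2 gaussian"
  have isometry: "l2_inner (U f) (U g) = l2_inner f g" for f g
    using U by (simp add: metaplectic_def unitary_def)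
  \<comment> \<open>Pulling \<open>(x, 0)\<close> back through \<open>S\<close> puts both shifts
    under \<open>U\<close>, where isometry removes \<open>U\<close>; afterwards \<open>U\<close> is
    restored around the combined shift.\<close>
  obtain v where v: "S v = (x, 0)" using S(2) by (metis surjD)
  have "conv_dist k gaussian (x, y) = l2_inner (U (rho (y, 0) 0 ?\<phi>)) (U (rho v 0 (inv U ?\<phi>)))"
    by (simp add: conv_dist_gaussian_kernel[OF k] metaplectic_rho[OF U] v)
  then have "norm (conv_dist k gaussian (x, y)) = norm (l2_inner ?\<phi> (rho (v - (y, 0)) 0 (inv U ?\<phi>)))"
    by (simp only: isometry norm_l2_inner_rho_rho)
  also have "\<dots> = norm (l2_inner (U ?\<phi>) (U (rho (v - (y, 0)) 0 (inv U ?\<phi>))))"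
    by (simp only: isometry)
  also have "\<dots> = norm (gabor (U ?\<phi>) ((x, 0) - S (y, 0)))"
    by (simp add: metaplectic_rho[OF U] gabor_def linear_diff[OF S(1)] v)
  finally show ?thesis .
qed

text \<open>The sum of the system for \<open>J\<close> at \<open>S u\<close> and the conjugate
  system transported by \<open>S\<close> at \<open>u\<close> no longer contains
  \<open>F' (S u)\<close>, and what is left is a derivative in the single direction
  \<open>w + S (adjoint S w)\<close>.\<close>

lemma metaplectic_gabor_derivative:
  fixes U :: "(real^'n) l2 \<Rightarrow> (real^'n) l2"
  assumes U: "metaplectic S U" and S: "linear S" "surj S"
    and symp: "\<And>v w. S v \<bullet> rot90 (S w) = v \<bullet> rot90 w"
  shows "\<exists>F'. (gabor (U (abs_l2 gaussian)) has_derivative F') (at z) \<and>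
    (\<forall>w. \<exists>r. F' (w + S (adjoint S w)) = Complex (- 2 * pi * (z \<bullet> w)) r * gabor (U (abs_l2 gaussian)) z)"
proof -
  let ?F = "gabor (U (abs_l2 gaussian))" and ?H = "gabor (inv U (abs_l2 gaussian))"
  obtain v where v: "z = S v" using S(2) by (metis surjD)
  obtain F' where F': "(?F has_derivative F') (at z)"
    and CR1: "\<And>w. F' (rot90 w) + \<i> * F' w = - pi * Complex (z \<bullet> rot90 w) (z \<bullet> w) * ?F z"
    using gabor_cauchy_riemann by blast
  obtain H' where H': "(?H has_derivative H') (at (- v))"
    and CRH: "\<And>w. H' (rot90 w) + \<i> * H' w = - pi * Complex (- v \<bullet> rot90 w) (- v \<bullet> w) * ?H (- v)"
    using gabor_cauchy_riemann by blast
  interpret F': linear F' by (rule has_derivative_linear[OF F'])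
  interpret H': linear H' by (rule has_derivative_linear[OF H'])
  have "(S has_derivative S) (at v)"
    using S(1) by (simp add: linear_conv_bounded_linear bounded_linear_imp_has_derivative)
  then have "((\<lambda>w. ?F (S w)) has_derivative (\<lambda>w. F' (S w))) (at v)"
    by (rule has_derivative_compose) (use F' v in simp)
  moreover have "((\<lambda>w. cnj (?H (- w))) has_derivative (\<lambda>w. cnj (H' (- w)))) (at v)"
    by (intro has_derivative_cnj has_derivative_compose[where f = uminus and g = ?H, OF _ H']
          derivative_intros)
  \<comment> \<open>Both are derivatives at \<open>v\<close> of one and the same function, by
    \<open>metaplectic_gabor\<close>.\<close>
  ultimately have chain: "F' (S w) = cnj (H' (- w))" for w
    unfolding metaplectic_gabor[OF U] by (metis has_derivative_unique)
  have Fz: "?F z = cnj (?H (- v))" by (simp add: v metaplectic_gabor[OF U])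
  have CR2: "F' (S (rot90 u)) - \<i> * F' (S u) = - pi * Complex (v \<bullet> rot90 u) (- (v \<bullet> u)) * ?F z" for u
  proof -
    have "F' (S (rot90 u)) - \<i> * F' (S u) = - cnj (H' (rot90 u) + \<i> * H' u)"
      by (simp add: chain H'.neg)
    also have "\<dots> = - pi * Complex (v \<bullet> rot90 u) (- (v \<bullet> u)) * ?F z"
      unfolding CRH Fz by (simp add: complex_eq_iff)
    finally show ?thesis .
  qed
  have "\<exists>r. F' (w + S (adjoint S w)) = Complex (- 2 * pi * (z \<bullet> w)) r * ?F z" for w
  proof -
    \<comment> \<open>This \<open>u\<close> satisfies \<open>rot90 (S u) = w\<close>, and
      preservation of the symplectic form turns \<open>adjoint S w\<close> into
      \<open>rot90 u\<close>.\<close>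
    obtain u where u: "S u = - rot90 w" using S(2) by (metis surjD)
    have w: "rot90 (S u) = w" 
      by (cases w) (simp add: u rot90_def)
    have "adjoint S w = rot90 u"
    proof (rule vector_eq_ldot[THEN iffD1], rule allI)
      show "x \<bullet> adjoint S w = x \<bullet> rot90 u" for x
        using symp[of x u] by (simp add: adjoint_works[OF S(1)] w)
    qed
    then have "F' (w + S (adjoint S w)) = F' (rot90 (S u)) + \<i> * F' (S u) + (F' (S (rot90 u)) - \<i> * F' (S u))"
      by (simp add: F'.add w)
    also have "\<dots> = - pi * (Complex (z \<bullet> w) (z \<bullet> S u) + Complex (v \<bullet> rot90 u) (- (v \<bullet> u))) * ?F z"
      using CR1[of "S u"] unfolding w CR2 by (simp only: distrib_left distrib_right)
    also have "v \<bullet> rot90 u = z \<bullet> w" using symp[of v u] by (simp add: v w)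
    \<comment> \<open>The two systems contribute equal real parts, hence the factor 2; the remaining
      imaginary part is the unspecified \<open>r\<close>.\<close>
    also have "- pi * (Complex (z \<bullet> w) (z \<bullet> S u) + Complex (z \<bullet> w) (- (v \<bullet> u))) =
        Complex (- 2 * pi * (z \<bullet> w)) (- pi * (z \<bullet> S u - v \<bullet> u))"
      by (simp add: complex_eq_iff algebra_simps)
    finally show ?thesis by blast
  qed
  with F' show ?thesis by blast
qed

theorem theorem3p1:
  fixes A B C D :: "real^'n^'n"
    and U :: "(real^'n) l2 \<Rightarrow> (real^'n) l2"
    and k :: "((real^'n) \<times> (real^'n) \<Rightarrow> complex) \<Rightarrow> complex"
  assumes "symplectic A B C D"
    and "metaplectic (block_apply A B C D) U"
    and "schwartz_kernel (op_dist U) k"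
  shows "\<exists>c Q. c > 0 \<and> psd_quadratic_form Q \<and>
           (\<forall>x y. norm (conv_dist k gaussian (x, y)) = c * exp (- pi * Q (x, y))) \<and>
           {(x, y). Q (x, y) = 0} =
             {(x, transpose D *v x) | x. x \<in> orthogonal_comp (range ((*v) C))}"
proof -
  let ?S = "block_apply A B C D"
  let ?F = "gabor (U (abs_l2 gaussian))"
  have S: "linear ?S" "surj ?S"
    by (rule linear_block_apply, rule surj_block_apply[OF assms(1)])
  obtain R where R: "linear R" "\<And>z. R z + ?S (adjoint ?S (R z)) = z"
    "\<And>z. z \<bullet> R z \<ge> 0" "\<And>z. z \<bullet> R z = 0 \<longleftrightarrow> z = 0"
    using inverse_id_plus_S_adjoint[OF S(1)] by blast
  have F: "norm (?F z) = norm (?F 0) * exp (- pi * (z \<bullet> R z))" for z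
  proof (rule norm_eq_gaussian_if_log_derivative[OF _ R(1)])
    fix z
    obtain F' where F': "(?F has_derivative F') (at z)"
      and log: "\<And>w. \<exists>r. F' (w + ?S (adjoint ?S w)) = Complex (- 2 * pi * (z \<bullet> w)) r * ?F z"
      using metaplectic_gabor_derivative[OF assms(2) S block_apply_inner_rot90[OF assms(1)]] by blast
    \<comment> \<open>Directions of the form \<open>w + S (adjoint S w)\<close> exhaust the space,
      and \<open>R\<close> solves for \<open>w\<close>.\<close>
    have "\<exists>r. F' w = Complex (- 2 * pi * (z \<bullet> R w)) r * ?F z" for w
      using log[of "R w"] by (simp only: R(2))
    with F' show "\<exists>F'. (?F has_derivative F') (at z) \<and>
        (\<forall>w. \<exists>r. F' w = Complex (- 2 * pi * (z \<bullet> R w)) r * ?F z)" by blast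
  qed
  have "l2_inner (U (abs_l2 gaussian)) (U (abs_l2 gaussian)) \<noteq> 0"
    using assms(2) l2_inner_gaussian_nonzero by (simp add: metaplectic_def unitary_def)
  then obtain z where "?F z \<noteq> 0" using gabor_nonzero by blast
  \<comment> \<open>By \<open>F\<close>, vanishing at 0 would mean vanishing everywhere.\<close>
  then have pos: "norm (?F 0) > 0" using F[of z] by auto
  \<comment> \<open>\<open>Q\<close> is the positive definite form of \<open>R\<close> pulled back
    along this linear map, so its zero set is the kernel of \<open>Z\<close>.\<close>
  define Z where "Z = (\<lambda>(x, y). (x, 0) - ?S (y, 0))"
  define Q where "Q = (\<lambda>w. Z w \<bullet> R (Z w))"
  have Z: "linear Z"
    unfolding Z_def
    by (auto intro!: linearI simp: block_apply_def algebra_simps matrix_vector_mult_scaleR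
        matrix_vector_right_distrib)
  have "bilinear (\<lambda>v w. Z v \<bullet> R (Z w))"
    unfolding bilinear_def
    by (intro conjI allI linearI)
      (simp_all add: linear_add[OF Z] linear_cmul[OF Z] linear_add[OF R(1)] linear_cmul[OF R(1)]
          inner_add_left inner_add_right)
  then have psd: "psd_quadratic_form Q"
    unfolding psd_quadratic_form_def Q_def by (auto simp: R(3))
  have "norm (conv_dist k gaussian (x, y)) = norm (?F 0) * exp (- pi * Q (x, y))" for x y
    unfolding metaplectic_norm_conv_dist[OF assms(2) S assms(3)]
    by (subst F) (simp only: Q_def Z_def prod.case)
  moreover have "{(x, y). Q (x, y) = 0} =
      {(x, transpose D *v x) | x. x \<in> orthogonal_comp (range ((*v) C))}"
  proof -
    have "Q (x, y) = 0 \<longleftrightarrow> (x, 0) = ?S (y, 0)" for x y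
      by (simp only: Q_def Z_def R(4) prod.case right_minus_eq)
    then show ?thesis by (simp only: block_apply_zero_set[OF assms(1)]) blast
  qed
  ultimately show ?thesis using pos psd by blast
qed

end
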